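(* Let $(M,J,g)$ be a connected Vaisman manifold of real dimension $2n\ge 4$ whose Lee form $\theta$ is non-zero. Then the holonomy group $\operatorname{Hol}^b(M)$ of the Bismut connection $\nabla^b$ of $(M,J,g)$ is contained in $\operatorname{U}(n-1)$, where $\operatorname{U}(n-1)$ is regarded as a subgroup of $\operatorname{U}(n)$ via $B\mapsto \begin{pmatrix}1&0\\0&B\end{pmatrix}$.
   Context: Let $(M,J,g)$ be a Hermitian manifold ($J$ an integrable complex structure, $g$ a $J$-Hermitian Riemannian metric) with fundamental $2$-form $\omega(X,Y)=g(JX,Y)$ and Levi-Civita connection $\nabla^g$. It is locally conformally Kähler (LCK) if there is a closed $1$-form $\theta$ (the Lee form) with $d\omega=\theta\wedge\omega$; it is Vaisman if moreover $\nabla^g\theta=0$. The Bismut connection $\nabla^b$ is the unique connection with $\nabla^b g=0$, $\nabla^b J=0$ and totally skew-symmetric torsion; explicitly $g(\nabla^b_XY,Z)=g(\nabla^g_XY,Z)+\tfrac12 d\omega(JX,JY,JZ)$. Since $\nabla^b$ is Hermitian, its holonomy group is (up to conjugation, via a choice of unitary basis of a tangent space) a subgroup of $\operatorname{U}(n)$; containment is understood up to this choice of unitary basis. *)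

theory Defs
  imports "HOL-Analysis.Analysis" "Jordan_Normal_Form.Schur_Decomposition"
begin

section \<open>Smooth manifolds\<close>

primrec Ck_on :: "nat \<Rightarrow> 'a::euclidean_space set \<Rightarrow> ('a \<Rightarrow> 'b::real_normed_vector) \<Rightarrow> bool" where
  "Ck_on 0 S f \<longleftrightarrow> continuous_on S f"
| "Ck_on (Suc k) S f \<longleftrightarrow>
     (\<forall>x\<in>S. f differentiable (at x)) \<and> (\<forall>v. Ck_on k S (\<lambda>x. frechet_derivative f (at x) v))"

text \<open>Smoothness is only used for functions on open sets.\<close>

definition smooth_on :: "'a::euclidean_space set \<Rightarrow> ('a \<Rightarrow> 'b::real_normed_vector) \<Rightarrow> bool" where
  "smooth_on S f \<longleftrightarrow> (\<forall>k. Ck_on k S f)"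

datatype ('m, 'e) chart = Chart (chart_dom: "'m set") (chart_map: "'m \<Rightarrow> 'e")

definition chart_inv :: "('m, 'e) chart \<Rightarrow> 'e \<Rightarrow> 'm" where
  "chart_inv c = inv_into (chart_dom c) (chart_map c)"

definition charts_at :: "('m, 'e) chart set \<Rightarrow> 'm \<Rightarrow> ('m, 'e) chart set" where
  "charts_at A p = {c \<in> A. p \<in> chart_dom c}"

locale smooth_manifold =
  fixes A :: "('m::{second_countable_topology, t2_space}, 'e::euclidean_space) chart set"
  assumes chart_open: "c \<in> A \<Longrightarrow> open (chart_dom c) \<and> open (chart_map c ` chart_dom c)"
    and chart_homeo:
      "c \<in> A \<Longrightarrow> homeomorphism (chart_dom c) (chart_map c ` chart_dom c) (chart_map c) (chart_inv c)"
    and charts_cover: "(\<Union>c\<in>A. chart_dom c) = UNIV"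
    and charts_compatible: "c \<in> A \<Longrightarrow> c' \<in> A \<Longrightarrow>
      smooth_on (chart_map c ` (chart_dom c \<inter> chart_dom c')) (chart_map c' \<circ> chart_inv c)"

definition smooth_fun_on ::
  "('m::topological_space, 'e::euclidean_space) chart set \<Rightarrow> 'm set \<Rightarrow> ('m \<Rightarrow> real) \<Rightarrow> bool" where
  "smooth_fun_on A U f \<longleftrightarrow>
     (\<forall>c\<in>A. smooth_on (chart_map c ` (U \<inter> chart_dom c)) (f \<circ> chart_inv c))"

definition smooth_fun_near ::
  "('m::topological_space, 'e::euclidean_space) chart set \<Rightarrow> 'm \<Rightarrow> ('m \<Rightarrow> real) \<Rightarrow> bool" where
  "smooth_fun_near A p f \<longleftrightarrow> (\<exists>U. open U \<and> p \<in> U \<and> smooth_fun_on A U f)"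

section \<open>Tangent vectors and vector fields\<close>

text \<open>A tangent vector at \<open>p\<close> is the family of its coordinate vectors in all the charts around
  \<open>p\<close>, related by the derivatives of the transition maps; at charts that do not contain \<open>p\<close> the
  family takes the dummy value \<open>0\<close>.  The vector space structure is pointwise.\<close>

type_synonym ('m, 'e) tangent = "('m, 'e) chart \<Rightarrow> 'e"

definition tangent_space ::
  "('m, 'e::euclidean_space) chart set \<Rightarrow> 'm \<Rightarrow> ('m, 'e) tangent set" where
  "tangent_space A p = {v. (\<forall>c. c \<notin> charts_at A p \<longrightarrow> v c = 0) \<and>
     (\<forall>c\<in>charts_at A p. \<forall>c'\<in>charts_at A p.
        v c' = frechet_derivative (chart_map c' \<circ> chart_inv c) (at (chart_map c p)) (v c))}"

definition lincomb ::
  "real \<Rightarrow> ('m, 'e::real_vector) tangent \<Rightarrow> real \<Rightarrow> ('m, 'e) tangent \<Rightarrow> ('m, 'e) tangent" where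
  "lincomb a v b w = (\<lambda>c. a *\<^sub>R v c + b *\<^sub>R w c)"

text \<open>The tangent vector at \<open>p\<close> with coordinate vector \<open>u\<close> in the chart \<open>c\<close>.\<close>

definition coord_vector ::
  "('m, 'e::euclidean_space) chart set \<Rightarrow> ('m, 'e) chart \<Rightarrow> 'm \<Rightarrow> 'e \<Rightarrow> ('m, 'e) tangent" where
  "coord_vector A c p u = (\<lambda>c'. if c' \<in> charts_at A p
     then frechet_derivative (chart_map c' \<circ> chart_inv c) (at (chart_map c p)) u else 0)"

definition smooth_field_on ::
  "('m::topological_space, 'e::euclidean_space) chart set \<Rightarrow> 'm set \<Rightarrow> ('m \<Rightarrow> ('m, 'e) tangent) \<Rightarrow> bool"
where
  "smooth_field_on A U X \<longleftrightarrow> (\<forall>p\<in>U. X p \<in> tangent_space A p) \<and>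
     (\<forall>c\<in>A. smooth_on (chart_map c ` (U \<inter> chart_dom c)) (\<lambda>x. X (chart_inv c x) c))"

definition smooth_field_near ::
  "('m::topological_space, 'e::euclidean_space) chart set \<Rightarrow> 'm \<Rightarrow> ('m \<Rightarrow> ('m, 'e) tangent) \<Rightarrow> bool"
where
  "smooth_field_near A p X \<longleftrightarrow> (\<exists>U. open U \<and> p \<in> U \<and> smooth_field_on A U X)"

text \<open>The derivative \<open>v(f)\<close> of \<open>f\<close> along \<open>v \<in> T\<^sub>pM\<close>; it does not depend on the chart.\<close>

definition deriv_along ::
  "('m, 'e::euclidean_space) chart set \<Rightarrow> 'm \<Rightarrow> ('m, 'e) tangent \<Rightarrow> ('m \<Rightarrow> real) \<Rightarrow> real" where
  "deriv_along A p v f = (let c = (SOME c. c \<in> charts_at A p) in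
     frechet_derivative (f \<circ> chart_inv c) (at (chart_map c p)) (v c))"

definition lie_bracket ::
  "('m, 'e::euclidean_space) chart set \<Rightarrow> ('m \<Rightarrow> ('m, 'e) tangent) \<Rightarrow> ('m \<Rightarrow> ('m, 'e) tangent)
     \<Rightarrow> 'm \<Rightarrow> ('m, 'e) tangent" where
  "lie_bracket A X Y p = (\<lambda>c. if c \<in> charts_at A p
     then frechet_derivative (\<lambda>x. Y (chart_inv c x) c) (at (chart_map c p)) (X p c)
        - frechet_derivative (\<lambda>x. X (chart_inv c x) c) (at (chart_map c p)) (Y p c)
     else 0)"

section \<open>Differential forms\<close>

definition smooth_1form ::
  "('m::topological_space, 'e::euclidean_space) chart set \<Rightarrow> ('m \<Rightarrow> ('m, 'e) tangent \<Rightarrow> real) \<Rightarrow> bool"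
where
  "smooth_1form A \<theta> \<longleftrightarrow>
     (\<forall>p. \<forall>v\<in>tangent_space A p. \<forall>w\<in>tangent_space A p. \<forall>a b.
        \<theta> p (lincomb a v b w) = a * \<theta> p v + b * \<theta> p w) \<and>
     (\<forall>U X. open U \<and> smooth_field_on A U X \<longrightarrow> smooth_fun_on A U (\<lambda>p. \<theta> p (X p)))"

text \<open>The exterior derivatives of a \<open>1\<close>-form and of a \<open>2\<close>-form, evaluated on vector fields, and
  the wedge product of a \<open>1\<close>-form with a \<open>2\<close>-form, in the normalisation without factors
  \<open>1/2\<close> and \<open>1/3\<close>.\<close>

definition ext_deriv1 ::
  "('m, 'e::euclidean_space) chart set \<Rightarrow> ('m \<Rightarrow> ('m, 'e) tangent \<Rightarrow> real)
     \<Rightarrow> 'm \<Rightarrow> ('m \<Rightarrow> ('m, 'e) tangent) \<Rightarrow> ('m \<Rightarrow> ('m, 'e) tangent) \<Rightarrow> real" where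
  "ext_deriv1 A \<theta> p X Y =
     deriv_along A p (X p) (\<lambda>q. \<theta> q (Y q)) - deriv_along A p (Y p) (\<lambda>q. \<theta> q (X q))
     - \<theta> p (lie_bracket A X Y p)"

definition ext_deriv2 ::
  "('m, 'e::euclidean_space) chart set \<Rightarrow> ('m \<Rightarrow> ('m, 'e) tangent \<Rightarrow> ('m, 'e) tangent \<Rightarrow> real)
     \<Rightarrow> 'm \<Rightarrow> ('m \<Rightarrow> ('m, 'e) tangent) \<Rightarrow> ('m \<Rightarrow> ('m, 'e) tangent) \<Rightarrow> ('m \<Rightarrow> ('m, 'e) tangent) \<Rightarrow> real"
where
  "ext_deriv2 A \<omega> p X Y Z =
     deriv_along A p (X p) (\<lambda>q. \<omega> q (Y q) (Z q))
     + deriv_along A p (Y p) (\<lambda>q. \<omega> q (Z q) (X q))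
     + deriv_along A p (Z p) (\<lambda>q. \<omega> q (X q) (Y q))
     - \<omega> p (lie_bracket A X Y p) (Z p)
     - \<omega> p (lie_bracket A Y Z p) (X p)
     - \<omega> p (lie_bracket A Z X p) (Y p)"

definition wedge12 ::
  "('t \<Rightarrow> real) \<Rightarrow> ('t \<Rightarrow> 't \<Rightarrow> real) \<Rightarrow> 't \<Rightarrow> 't \<Rightarrow> 't \<Rightarrow> real" where
  "wedge12 \<alpha> \<beta> u v w = \<alpha> u * \<beta> v w + \<alpha> v * \<beta> w u + \<alpha> w * \<beta> u v"

section \<open>Hermitian manifolds\<close>

locale riemannian_manifold = smooth_manifold A
  for A :: "('m::{second_countable_topology, t2_space}, 'e::euclidean_space) chart set" +
  fixes g :: "'m \<Rightarrow> ('m, 'e) tangent \<Rightarrow> ('m, 'e) tangent \<Rightarrow> real"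
  assumes metric_sym: "u \<in> tangent_space A p \<Longrightarrow> v \<in> tangent_space A p \<Longrightarrow> g p u v = g p v u"
    and metric_linear: "u \<in> tangent_space A p \<Longrightarrow> v \<in> tangent_space A p \<Longrightarrow> w \<in> tangent_space A p \<Longrightarrow>
      g p (lincomb a u b v) w = a * g p u w + b * g p v w"
    and metric_pos: "v \<in> tangent_space A p \<Longrightarrow> v \<noteq> (\<lambda>c. 0) \<Longrightarrow> g p v v > 0"
    and metric_smooth: "open U \<Longrightarrow> smooth_field_on A U X \<Longrightarrow> smooth_field_on A U Y \<Longrightarrow>
      smooth_fun_on A U (\<lambda>p. g p (X p) (Y p))"

text \<open>Integrability of \<open>J\<close> is the vanishing of its Nijenhuis tensor.\<close>

locale complex_structure = smooth_manifold A
  for A :: "('m::{second_countable_topology, t2_space}, 'e::euclidean_space) chart set" +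
  fixes J :: "'m \<Rightarrow> ('m, 'e) tangent \<Rightarrow> ('m, 'e) tangent"
  assumes J_tangent: "v \<in> tangent_space A p \<Longrightarrow> J p v \<in> tangent_space A p"
    and J_linear: "v \<in> tangent_space A p \<Longrightarrow> w \<in> tangent_space A p \<Longrightarrow>
      J p (lincomb a v b w) = lincomb a (J p v) b (J p w)"
    and J_square: "v \<in> tangent_space A p \<Longrightarrow> J p (J p v) = (\<lambda>c. - v c)"
    and J_smooth: "open U \<Longrightarrow> smooth_field_on A U X \<Longrightarrow> smooth_field_on A U (\<lambda>p. J p (X p))"
    and J_integrable: "smooth_field_near A p X \<Longrightarrow> smooth_field_near A p Y \<Longrightarrow>
      lie_bracket A (\<lambda>q. J q (X q)) (\<lambda>q. J q (Y q)) p c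
        - J p (lie_bracket A (\<lambda>q. J q (X q)) Y p) c
        - J p (lie_bracket A X (\<lambda>q. J q (Y q)) p) c
        - lie_bracket A X Y p c = 0"

locale hermitian_manifold = complex_structure A J + riemannian_manifold A g
  for A :: "('m::{second_countable_topology, t2_space}, 'e::euclidean_space) chart set"
    and J :: "'m \<Rightarrow> ('m, 'e) tangent \<Rightarrow> ('m, 'e) tangent"
    and g :: "'m \<Rightarrow> ('m, 'e) tangent \<Rightarrow> ('m, 'e) tangent \<Rightarrow> real" +
  assumes hermitian: "u \<in> tangent_space A p \<Longrightarrow> v \<in> tangent_space A p \<Longrightarrow>
    g p (J p u) (J p v) = g p u v"

definition fundamental_form ::
  "('m \<Rightarrow> ('m, 'e) tangent \<Rightarrow> ('m, 'e) tangent) \<Rightarrow> ('m \<Rightarrow> ('m, 'e) tangent \<Rightarrow> ('m, 'e) tangent \<Rightarrow> real)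
     \<Rightarrow> 'm \<Rightarrow> ('m, 'e) tangent \<Rightarrow> ('m, 'e) tangent \<Rightarrow> real" where
  "fundamental_form J g p u v = g p (J p u) v"

section \<open>Connections\<close>

text \<open>\<open>D p v Y\<close> is the covariant derivative of \<open>Y\<close> in the direction \<open>v \<in> T\<^sub>pM\<close>, where \<open>Y\<close> is a
  vector field defined and smooth near \<open>p\<close> (its values away from \<open>p\<close> are irrelevant).\<close>

type_synonym ('m, 'e) connection =
  "'m \<Rightarrow> ('m, 'e) tangent \<Rightarrow> ('m \<Rightarrow> ('m, 'e) tangent) \<Rightarrow> ('m, 'e) tangent"

locale linear_connection = smooth_manifold A
  for A :: "('m::{second_countable_topology, t2_space}, 'e::euclidean_space) chart set" +
  fixes D :: "('m, 'e) connection"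
  assumes connection_tangent: "v \<in> tangent_space A p \<Longrightarrow> smooth_field_near A p Y \<Longrightarrow>
      D p v Y \<in> tangent_space A p"
    and connection_linear: "v \<in> tangent_space A p \<Longrightarrow> w \<in> tangent_space A p \<Longrightarrow>
      smooth_field_near A p Y \<Longrightarrow> D p (lincomb a v b w) Y = lincomb a (D p v Y) b (D p w Y)"
    and connection_add: "v \<in> tangent_space A p \<Longrightarrow> smooth_field_near A p Y \<Longrightarrow>
      smooth_field_near A p Z \<Longrightarrow> D p v (\<lambda>q c. Y q c + Z q c) = (\<lambda>c. D p v Y c + D p v Z c)"
    and connection_leibniz: "v \<in> tangent_space A p \<Longrightarrow> smooth_fun_near A p f \<Longrightarrow>
      smooth_field_near A p Y \<Longrightarrow>
      D p v (\<lambda>q c. f q *\<^sub>R Y q c) = lincomb (deriv_along A p v f) (Y p) (f p) (D p v Y)"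
    and connection_local: "v \<in> tangent_space A p \<Longrightarrow> smooth_field_near A p Y \<Longrightarrow>
      open U \<Longrightarrow> p \<in> U \<Longrightarrow> (\<And>q. q \<in> U \<Longrightarrow> Y q = Z q) \<Longrightarrow> D p v Y = D p v Z"
    and connection_smooth: "open U \<Longrightarrow> smooth_field_on A U X \<Longrightarrow> smooth_field_on A U Y \<Longrightarrow>
      smooth_field_on A U (\<lambda>p. D p (X p) Y)"

definition torsion ::
  "('m, 'e::euclidean_space) chart set \<Rightarrow> ('m, 'e) connection
     \<Rightarrow> ('m \<Rightarrow> ('m, 'e) tangent) \<Rightarrow> ('m \<Rightarrow> ('m, 'e) tangent) \<Rightarrow> 'm \<Rightarrow> ('m, 'e) tangent" where
  "torsion A D X Y p = (\<lambda>c. D p (X p) Y c - D p (Y p) X c - lie_bracket A X Y p c)"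

definition metric_parallel ::
  "('m::topological_space, 'e::euclidean_space) chart set
     \<Rightarrow> ('m \<Rightarrow> ('m, 'e) tangent \<Rightarrow> ('m, 'e) tangent \<Rightarrow> real) \<Rightarrow> ('m, 'e) connection \<Rightarrow> bool" where
  "metric_parallel A g D \<longleftrightarrow> (\<forall>p Y Z. \<forall>v\<in>tangent_space A p.
     smooth_field_near A p Y \<and> smooth_field_near A p Z \<longrightarrow>
     deriv_along A p v (\<lambda>q. g q (Y q) (Z q)) = g p (D p v Y) (Z p) + g p (Y p) (D p v Z))"

definition endo_parallel ::
  "('m::topological_space, 'e::euclidean_space) chart set
     \<Rightarrow> ('m \<Rightarrow> ('m, 'e) tangent \<Rightarrow> ('m, 'e) tangent) \<Rightarrow> ('m, 'e) connection \<Rightarrow> bool" where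
  "endo_parallel A J D \<longleftrightarrow> (\<forall>p Y. \<forall>v\<in>tangent_space A p.
     smooth_field_near A p Y \<longrightarrow> D p v (\<lambda>q. J q (Y q)) = J p (D p v Y))"

definition form_parallel ::
  "('m::topological_space, 'e::euclidean_space) chart set
     \<Rightarrow> ('m \<Rightarrow> ('m, 'e) tangent \<Rightarrow> real) \<Rightarrow> ('m, 'e) connection \<Rightarrow> bool" where
  "form_parallel A \<theta> D \<longleftrightarrow> (\<forall>p Y. \<forall>v\<in>tangent_space A p.
     smooth_field_near A p Y \<longrightarrow> deriv_along A p v (\<lambda>q. \<theta> q (Y q)) = \<theta> p (D p v Y))"

definition levi_civita_connection ::
  "('m::{second_countable_topology, t2_space}, 'e::euclidean_space) chart set
     \<Rightarrow> ('m \<Rightarrow> ('m, 'e) tangent \<Rightarrow> ('m, 'e) tangent \<Rightarrow> real) \<Rightarrow> ('m, 'e) connection \<Rightarrow> bool" where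
  "levi_civita_connection A g D \<longleftrightarrow> linear_connection A D \<and> metric_parallel A g D \<and>
     (\<forall>p X Y. smooth_field_near A p X \<and> smooth_field_near A p Y \<longrightarrow> torsion A D X Y p = (\<lambda>c. 0))"

definition skew_torsion ::
  "('m::topological_space, 'e::euclidean_space) chart set
     \<Rightarrow> ('m \<Rightarrow> ('m, 'e) tangent \<Rightarrow> ('m, 'e) tangent \<Rightarrow> real) \<Rightarrow> ('m, 'e) connection \<Rightarrow> bool" where
  "skew_torsion A g D \<longleftrightarrow> (\<forall>p X Y Z.
     smooth_field_near A p X \<and> smooth_field_near A p Y \<and> smooth_field_near A p Z \<longrightarrow>
     g p (torsion A D X Y p) (Z p) = - g p (torsion A D Y X p) (Z p) \<and>
     g p (torsion A D X Y p) (Z p) = - g p (torsion A D X Z p) (Y p))"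

definition bismut_connection ::
  "('m::{second_countable_topology, t2_space}, 'e::euclidean_space) chart set
     \<Rightarrow> ('m \<Rightarrow> ('m, 'e) tangent \<Rightarrow> ('m, 'e) tangent)
     \<Rightarrow> ('m \<Rightarrow> ('m, 'e) tangent \<Rightarrow> ('m, 'e) tangent \<Rightarrow> real) \<Rightarrow> ('m, 'e) connection \<Rightarrow> bool" where
  "bismut_connection A J g D \<longleftrightarrow>
     linear_connection A D \<and> metric_parallel A g D \<and> endo_parallel A J D \<and> skew_torsion A g D"

section \<open>Vaisman manifolds\<close>

locale lck_manifold = hermitian_manifold A J g
  for A :: "('m::{second_countable_topology, t2_space}, 'e::euclidean_space) chart set"
    and J :: "'m \<Rightarrow> ('m, 'e) tangent \<Rightarrow> ('m, 'e) tangent"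
    and g :: "'m \<Rightarrow> ('m, 'e) tangent \<Rightarrow> ('m, 'e) tangent \<Rightarrow> real" +
  fixes \<theta> :: "'m \<Rightarrow> ('m, 'e) tangent \<Rightarrow> real"
  assumes lee_form: "smooth_1form A \<theta>"
    and lee_closed: "smooth_field_near A p X \<Longrightarrow> smooth_field_near A p Y \<Longrightarrow>
      ext_deriv1 A \<theta> p X Y = 0"
    and lck: "smooth_field_near A p X \<Longrightarrow> smooth_field_near A p Y \<Longrightarrow> smooth_field_near A p Z \<Longrightarrow>
      ext_deriv2 A (fundamental_form J g) p X Y Z
        = wedge12 (\<theta> p) (fundamental_form J g p) (X p) (Y p) (Z p)"

locale vaisman_manifold = lck_manifold A J g \<theta>
  for A :: "('m::{second_countable_topology, t2_space}, 'e::euclidean_space) chart set"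
    and J :: "'m \<Rightarrow> ('m, 'e) tangent \<Rightarrow> ('m, 'e) tangent"
    and g :: "'m \<Rightarrow> ('m, 'e) tangent \<Rightarrow> ('m, 'e) tangent \<Rightarrow> real"
    and \<theta> :: "'m \<Rightarrow> ('m, 'e) tangent \<Rightarrow> real" +
  assumes lee_parallel: "\<exists>D. levi_civita_connection A g D \<and> form_parallel A \<theta> D"

section \<open>Parallel transport and holonomy\<close>

text \<open>Smooth on a closed interval means: extends to a smooth curve on an open neighbourhood.\<close>

definition smooth_curve ::
  "('m::topological_space, 'e::euclidean_space) chart set \<Rightarrow> (real \<Rightarrow> 'm) \<Rightarrow> real \<Rightarrow> real \<Rightarrow> bool" where
  "smooth_curve A \<gamma> a b \<longleftrightarrow> (\<exists>I \<delta>. open I \<and> {a..b} \<subseteq> I \<and> continuous_on I \<delta> \<and>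
     (\<forall>t\<in>{a..b}. \<delta> t = \<gamma> t) \<and>
     (\<forall>c\<in>A. smooth_on {t \<in> I. \<delta> t \<in> chart_dom c} (chart_map c \<circ> \<delta>)))"

definition christoffel ::
  "('m, 'e::euclidean_space) chart set \<Rightarrow> ('m, 'e) connection \<Rightarrow> ('m, 'e) chart \<Rightarrow> 'm \<Rightarrow> 'e \<Rightarrow> 'e \<Rightarrow> 'e"
where
  "christoffel A D c p u w = D p (coord_vector A c p u) (\<lambda>q. coord_vector A c q w) c"

text \<open>The vanishing of the covariant derivative of \<open>V\<close> along \<open>\<gamma>\<close> on \<open>[a, b]\<close>, in coordinates:
  \<open>V' + \<Gamma>(\<gamma>', V) = 0\<close>, with one-sided derivatives at the end points.\<close>

definition parallel_along ::
  "('m::topological_space, 'e::euclidean_space) chart set \<Rightarrow> ('m, 'e) connection \<Rightarrow> (real \<Rightarrow> 'm)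
     \<Rightarrow> (real \<Rightarrow> ('m, 'e) tangent) \<Rightarrow> real \<Rightarrow> real \<Rightarrow> bool" where
  "parallel_along A D \<gamma> V a b \<longleftrightarrow> (\<forall>t\<in>{a..b}. V t \<in> tangent_space A (\<gamma> t) \<and>
     (\<forall>c\<in>charts_at A (\<gamma> t).
        ((\<lambda>s. V s c) has_vector_derivative
           - christoffel A D c (\<gamma> t)
               (vector_derivative (\<lambda>s. chart_map c (\<gamma> s)) (at t within {a..b})) (V t c))
        (at t within {a..b})))"

text \<open>The parallel transports \<open>T\<^sub>pM \<rightarrow> T\<^sub>pM\<close> along the piecewise smooth loops at \<open>p\<close>; the loop
  \<open>\<gamma>\<close> on \<open>[0, 1]\<close> is smooth on each interval of the subdivision \<open>\<tau> 0 < \<dots> < \<tau> N\<close>.\<close>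

definition holonomy_group ::
  "('m::topological_space, 'e::euclidean_space) chart set \<Rightarrow> ('m, 'e) connection \<Rightarrow> 'm
     \<Rightarrow> (('m, 'e) tangent \<Rightarrow> ('m, 'e) tangent) set" where
  "holonomy_group A D p = {P \<in> tangent_space A p \<rightarrow>\<^sub>E tangent_space A p.
     \<exists>\<gamma> N \<tau>. \<gamma> 0 = p \<and> \<gamma> 1 = p \<and> \<tau> 0 = 0 \<and> \<tau> N = 1 \<and>
       (\<forall>i<N. \<tau> i < \<tau> (Suc i) \<and> smooth_curve A \<gamma> (\<tau> i) (\<tau> (Suc i))) \<and>
       (\<forall>v\<in>tangent_space A p. \<exists>V. V 0 = v \<and> V 1 = P v \<and>
          (\<forall>i<N. parallel_along A D \<gamma> V (\<tau> i) (\<tau> (Suc i))))}"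

section \<open>Unitary groups and unitary bases\<close>

definition unitary_group :: "nat \<Rightarrow> complex mat set" where
  "unitary_group n = {B \<in> carrier_mat n n. B * mat_adjoint B = 1\<^sub>m n \<and> mat_adjoint B * B = 1\<^sub>m n}"

text \<open>The copy of \<open>U(n - 1)\<close> inside \<open>U(n)\<close>, for \<open>n \<ge> 1\<close>.\<close>

definition unitary_subgroup :: "nat \<Rightarrow> complex mat set" where
  "unitary_subgroup n =
     (\<lambda>B. four_block_mat (1\<^sub>m 1) (0\<^sub>m 1 (n - 1)) (0\<^sub>m (n - 1) 1) B) ` unitary_group (n - 1)"

text \<open>\<open>T\<^sub>pM\<close> is a complex vector space via \<open>\<i> v = J v\<close>.  The vectors \<open>e 0, \<dots>, e (n - 1)\<close> are
  unitary for the Hermitian form with real part \<open>g\<close> and imaginary part \<open>\<plusminus> g(J \<cdot>, \<cdot>)\<close>; when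
  \<open>dim M = 2n\<close> they form a basis.\<close>

definition unitary_basis ::
  "('m, 'e::euclidean_space) chart set \<Rightarrow> ('m \<Rightarrow> ('m, 'e) tangent \<Rightarrow> ('m, 'e) tangent)
     \<Rightarrow> ('m \<Rightarrow> ('m, 'e) tangent \<Rightarrow> ('m, 'e) tangent \<Rightarrow> real)
     \<Rightarrow> nat \<Rightarrow> 'm \<Rightarrow> (nat \<Rightarrow> ('m, 'e) tangent) \<Rightarrow> bool" where
  "unitary_basis A J g n p e \<longleftrightarrow> (\<forall>i<n. e i \<in> tangent_space A p) \<and>
     (\<forall>i<n. \<forall>j<n. g p (e i) (e j) = (if i = j then 1 else 0) \<and> g p (J p (e i)) (e j) = 0)"

definition complex_comb ::
  "('m \<Rightarrow> ('m, 'e) tangent \<Rightarrow> ('m, 'e::real_vector) tangent) \<Rightarrow> 'm \<Rightarrow> nat \<Rightarrow> (nat \<Rightarrow> ('m, 'e) tangent)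
     \<Rightarrow> complex Matrix.vec \<Rightarrow> ('m, 'e) tangent" where
  "complex_comb J p n e z =
     (\<lambda>c. \<Sum>i<n. Re (vec_index z i) *\<^sub>R e i c + Im (vec_index z i) *\<^sub>R J p (e i) c)"

text \<open>Every element of the holonomy group at \<open>p\<close> is, in the basis \<open>e\<close>, given by a matrix in \<open>H\<close>.\<close>

definition holonomy_contained ::
  "('m::topological_space, 'e::euclidean_space) chart set
     \<Rightarrow> ('m \<Rightarrow> ('m, 'e) tangent \<Rightarrow> ('m, 'e) tangent) \<Rightarrow> ('m, 'e) connection
     \<Rightarrow> nat \<Rightarrow> 'm \<Rightarrow> (nat \<Rightarrow> ('m, 'e) tangent) \<Rightarrow> complex mat set \<Rightarrow> bool" where
  "holonomy_contained A J D n p e H \<longleftrightarrow> (\<forall>P\<in>holonomy_group A D p. \<exists>B\<in>H.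
     \<forall>z\<in>carrier_vec n. P (complex_comb J p n e z) = complex_comb J p n e (B *\<^sub>v z))"

end

theory Submission
  imports Defs
begin

text \<open>For the Bismut connection the conditions \<open>\<nabla>g = 0\<close>, \<open>\<nabla>J = 0\<close> and the vanishing of the
  Nijenhuis tensor give \<open>g(T(X, Y), Z) = d\<omega>(JX, JY, JZ)\<close> for the torsion \<open>T\<close>.  If
  \<open>d\<omega> = \<theta> \<and> \<omega>\<close> and \<open>b\<close> is the vector field dual to \<open>\<theta>\<close>, the right hand side vanishes for
  \<open>Z = b\<close>.  As the Bismut and Levi-Civita connections differ by \<open>T / 2\<close>, the form \<open>\<theta>\<close> is parallel
  for the Bismut connection too.  A parallel form that is non-zero somewhere on a connected manifold
  is non-zero everywhere (in coordinates it solves a linear ordinary differential equation), so at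
  each point \<open>b / |b|\<close> extends to a unitary basis.  Holonomy preserves \<open>g\<close>, \<open>\<omega>\<close> and \<open>\<theta>\<close>; hence it
  is complex linear and unitary and fixes \<open>b\<close>.\<close>

section \<open>Calculus of \<open>C\<^sup>k\<close> maps\<close>

text \<open>An element of \<open>holonomy_group\<close> is merely a map \<open>P\<close> such that,
  for a common loop, every \<open>v\<close> is joined to \<open>P v\<close> by some parallel field.
  Neither linearity of \<open>P\<close> nor existence or uniqueness of solutions of the transport
  equation is part of this, and the proof does not go through them. All that it takes from a
  parallel field is a product rule: a parallel tensor evaluated on parallel fields has derivative 0
  along the curve. The invariance of \<open>g\<close>, \<omega> and \<theta> follows, and linearity,
  commutation with \<open>J\<close> and the fixed vector are then read off from defects whose
  squared length expands to 0. The vector \<open>b\<close> is chosen separately at each point and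
  extended by constant coefficients in a chart, so no smoothness of a dual field is involved.
  Tangent spaces are sets of coordinate families. Pointwise arguments are moved to \<open>'e\<close>
  by \<open>coord_vector\<close>, where the linear algebra of Euclidean spaces is available.\<close>

lemma has_derivative_frechet:
  "f differentiable (at x) \<Longrightarrow> (f has_derivative frechet_derivative f (at x)) (at x)"
  using frechet_derivative_works by blast

lemma frechet_derivative_cong_open:
  assumes "open S" "x \<in> S" "\<And>y. y \<in> S \<Longrightarrow> f y = g y"
  shows "frechet_derivative f (at x) = frechet_derivative g (at x)"
proof -
  have "(f has_derivative D) (at x) \<longleftrightarrow> (g has_derivative D) (at x)" for D
    using assms has_derivative_transform_within_open[of f D x UNIV S g]
      has_derivative_transform_within_open[of g D x UNIV S f] by auto
  then show ?thesis by (simp add: frechet_derivative_def)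
qed

lemma differentiable_cong_open:
  assumes "open S" "x \<in> S" "\<And>y. y \<in> S \<Longrightarrow> f y = g y"
  shows "f differentiable (at x) \<longleftrightarrow> g differentiable (at x)"
proof -
  have "(f has_derivative D) (at x) \<longleftrightarrow> (g has_derivative D) (at x)" for D
    using assms has_derivative_transform_within_open[of f D x UNIV S g]
      has_derivative_transform_within_open[of g D x UNIV S f] by auto
  then show ?thesis by (simp add: differentiable_def)
qed

lemma Ck_on_cong:
  assumes "open S" "\<And>x. x \<in> S \<Longrightarrow> f x = g x"
  shows "Ck_on k S f \<longleftrightarrow> Ck_on k S g"
  using assms
proof (induction k arbitrary: f g)
  case 0
  then show ?case by (simp cong: continuous_on_cong)
next
  case (Suc k)
  have "frechet_derivative f (at x) = frechet_derivative g (at x)" if "x \<in> S" for x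
    using Suc.prems that by (intro frechet_derivative_cong_open) auto
  then have "Ck_on k S (\<lambda>x. frechet_derivative f (at x) v)
      = Ck_on k S (\<lambda>x. frechet_derivative g (at x) v)" for v
    using Suc.prems by (intro Suc.IH) auto
  moreover have "f differentiable (at x) \<longleftrightarrow> g differentiable (at x)" if "x \<in> S" for x
    using Suc.prems that by (intro differentiable_cong_open) auto
  ultimately show ?case by simp
qed

lemma Ck_on_imp_continuous_on: "Ck_on k S f \<Longrightarrow> continuous_on S f"
  using differentiable_imp_continuous_within[where s = UNIV]
  by (cases k) (auto intro!: continuous_at_imp_continuous_on)

lemma Ck_on_SucD_derivative:
  "Ck_on (Suc k) S f \<Longrightarrow> x \<in> S \<Longrightarrow> (f has_derivative frechet_derivative f (at x)) (at x)"
  by (auto intro: has_derivative_frechet)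

lemma Ck_on_SucI:
  assumes "open S" "\<And>x. x \<in> S \<Longrightarrow> (f has_derivative F x) (at x)" "\<And>v. Ck_on k S (\<lambda>x. F x v)"
  shows "Ck_on (Suc k) S f"
proof -
  have "frechet_derivative f (at x) = F x" if "x \<in> S" for x
    using frechet_derivative_at[OF assms(2)[OF that]] by simp
  then have "Ck_on k S (\<lambda>x. frechet_derivative f (at x) v)" for v
    by (subst Ck_on_cong[OF assms(1), of _ "\<lambda>x. F x v"]) (simp_all add: assms(3))
  then show ?thesis using assms(2) by (auto simp: differentiable_def)
qed

lemma Ck_on_SucD: "Ck_on (Suc k) S f \<Longrightarrow> Ck_on k S f"
proof (induction k arbitrary: f)
  case 0
  then show ?case using Ck_on_imp_continuous_on[OF 0] by simp
next
  case (Suc k)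
  then have "Ck_on k S (\<lambda>x. frechet_derivative f (at x) v)" for v
    unfolding Ck_on.simps(2)[of "Suc k"] by blast
  then show ?case using Suc.prems by simp
qed

lemma Ck_on_const: "open S \<Longrightarrow> Ck_on k S (\<lambda>x. c)"
  by (induction k arbitrary: c) (auto simp: frechet_derivative_const)

lemma Ck_on_bounded_linear:
  assumes "bounded_linear L" "open S" "Ck_on k S f"
  shows "Ck_on k S (\<lambda>x. L (f x))"
  using assms(3)
proof (induction k arbitrary: f)
  case 0
  then show ?case
    using assms(1) by (auto intro: continuous_on_compose2[OF linear_continuous_on])
next
  case (Suc k)
  show ?case
    by (rule Ck_on_SucI[OF assms(2)
          bounded_linear.has_derivative[OF assms(1) Ck_on_SucD_derivative[OF Suc.prems]]])
       (use Suc.prems in \<open>auto intro!: Suc.IH simp del: Ck_on.simps(1)\<close>)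
qed

lemma Ck_on_add:
  assumes "open S" "Ck_on k S f" "Ck_on k S g"
  shows "Ck_on k S (\<lambda>x. f x + g x)"
  using assms(2,3)
proof (induction k arbitrary: f g)
  case 0
  then show ?case by (auto intro: continuous_on_add)
next
  case (Suc k)
  show ?case
    by (rule Ck_on_SucI[OF assms(1)
          has_derivative_add[OF Suc.prems[THEN Ck_on_SucD_derivative]]])
       (use Suc.prems in \<open>auto intro!: Suc.IH simp del: Ck_on.simps(1)\<close>)
qed

lemma Ck_on_sum:
  assumes "open S" "\<And>i. i \<in> I \<Longrightarrow> Ck_on k S (f i)"
  shows "Ck_on k S (\<lambda>x. \<Sum>i\<in>I. f i x)"
  using assms(2)
  by (induction I rule: infinite_finite_induct) (auto intro: Ck_on_const Ck_on_add assms(1))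

lemma Ck_on_scaleR:
  assumes "open S" "Ck_on k S f" "Ck_on k S g"
  shows "Ck_on k S (\<lambda>x. f x *\<^sub>R g x)"
  using assms(2,3)
proof (induction k arbitrary: f g)
  case 0
  then show ?case by (auto intro: continuous_on_scaleR)
next
  case (Suc k)
  note fg = Suc.prems[THEN Ck_on_SucD]
  show ?case
    by (rule Ck_on_SucI[OF assms(1)
          has_derivative_scaleR[OF Suc.prems[THEN Ck_on_SucD_derivative]]])
       (use Suc.prems fg in \<open>auto intro!: Ck_on_add Suc.IH assms(1) simp del: Ck_on.simps(1)\<close>)
qed

lemma Ck_on_compose:
  fixes g :: "'a::euclidean_space \<Rightarrow> 'b::euclidean_space"
  assumes "open S" "g ` S \<subseteq> T" "Ck_on k T f" "Ck_on k S g"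
  shows "Ck_on k S (\<lambda>x. f (g x))"
  using assms(3,4)
proof (induction k arbitrary: f)
  case 0
  then show ?case using assms(2) by (auto intro: continuous_on_compose2)
next
  case (Suc k)
  \<comment> \<open>\<open>Ck_on\<close> controls derivatives in a fixed direction only, whereas in
    the chain rule the direction \<open>Dg v\<close> varies with \<open>x\<close>. Expanding it over
    \<open>Basis\<close> turns the derivative into a sum of products to which the induction
    hypothesis applies.\<close>
  let ?D = "\<lambda>x v. \<Sum>b\<in>Basis. inner (frechet_derivative g (at x) v) b *\<^sub>R frechet_derivative f (at (g x)) b"
  have D: "((\<lambda>x. f (g x)) has_derivative ?D x) (at x)" if "x \<in> S" for x
  proof -
    have f: "(f has_derivative frechet_derivative f (at (g x))) (at (g x))"
      using that assms(2) by (intro Ck_on_SucD_derivative[OF Suc.prems(1)]) auto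
    have g: "(g has_derivative frechet_derivative g (at x)) (at x)"
      using that by (intro Ck_on_SucD_derivative[OF Suc.prems(2)])
    interpret L: bounded_linear "frechet_derivative f (at (g x))"
      using f has_derivative_bounded_linear by blast
    have *: "frechet_derivative f (at (g x)) w
        = (\<Sum>b\<in>Basis. inner w b *\<^sub>R frechet_derivative f (at (g x)) b)" for w
    proof -
      have "frechet_derivative f (at (g x)) (\<Sum>b\<in>Basis. inner w b *\<^sub>R b)
        = (\<Sum>b\<in>Basis. inner w b *\<^sub>R frechet_derivative f (at (g x)) b)"
        by (simp only: L.sum L.scaleR)
      then show ?thesis by (simp only: euclidean_representation)
    qed
    show ?thesis
      by (intro has_derivative_eq_rhs[OF has_derivative_compose[OF g f]] ext *)
  qed
  have "Ck_on k S (\<lambda>x. ?D x v)" for v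
  proof (intro Ck_on_sum Ck_on_scaleR assms(1))
    show "Ck_on k S (\<lambda>x. inner (frechet_derivative g (at x) v) b)" for b
      using Suc.prems by (intro Ck_on_bounded_linear[OF bounded_linear_inner_left] assms(1)) auto
    show "Ck_on k S (\<lambda>x. frechet_derivative f (at (g x)) b)" for b
      using Suc.prems(1) Ck_on_SucD[OF Suc.prems(2)]
      by (intro Suc.IH[of "\<lambda>y. frechet_derivative f (at y) b"]) auto
  qed
  then show ?case by (intro Ck_on_SucI[OF assms(1) D])
qed

lemma smooth_on_differentiable: "smooth_on S f \<Longrightarrow> x \<in> S \<Longrightarrow> f differentiable (at x)"
  unfolding smooth_on_def by (auto dest!: spec[of _ "Suc 0"])

lemma smooth_on_continuous: "smooth_on S f \<Longrightarrow> continuous_on S f"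
  unfolding smooth_on_def by (auto dest!: spec[of _ 0])

lemma smooth_on_frechet: "smooth_on S f \<Longrightarrow> smooth_on S (\<lambda>x. frechet_derivative f (at x) v)"
  unfolding smooth_on_def
proof
  fix k assume "\<forall>k. Ck_on k S f"
  then have "Ck_on (Suc k) S f" by blast
  then show "Ck_on k S (\<lambda>x. frechet_derivative f (at x) v)" by simp
qed

lemma smooth_on_compose:
  fixes g :: "'a::euclidean_space \<Rightarrow> 'b::euclidean_space"
  assumes "open S" "g ` S \<subseteq> T" "smooth_on T f" "smooth_on S g"
  shows "smooth_on S (\<lambda>x. f (g x))"
  using assms Ck_on_compose unfolding smooth_on_def by blast

lemma smooth_on_cong:
  assumes "open S" "\<And>x. x \<in> S \<Longrightarrow> f x = g x"
  shows "smooth_on S f \<longleftrightarrow> smooth_on S g"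
  using assms Ck_on_cong unfolding smooth_on_def by blast

section \<open>Tangent vectors in charts\<close>

context smooth_manifold
begin

lemma charts_atD: "c \<in> charts_at A p \<Longrightarrow> c \<in> A \<and> p \<in> chart_dom c"
  by (simp add: charts_at_def)

lemma charts_at_nonempty: "\<exists>c. c \<in> charts_at A p"
  using charts_cover by (auto simp: charts_at_def)

lemma chart_inv_map [simp]: "c \<in> A \<Longrightarrow> q \<in> chart_dom c \<Longrightarrow> chart_inv c (chart_map c q) = q"
  by (rule homeomorphism_apply1[OF chart_homeo])

lemma chart_map_open_image:
  assumes "c \<in> A" "open U"
  shows "open (chart_map c ` (U \<inter> chart_dom c))"
proof -
  have "openin (top_of_set (chart_map c ` chart_dom c)) (chart_map c ` (U \<inter> chart_dom c))"
    using assms by (intro homeomorphism_imp_open_map[OF chart_homeo])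
      (auto simp: openin_open Int_commute)
  then show ?thesis using chart_open[OF assms(1)] by (simp add: openin_open_eq)
qed

lemma transition_has_derivative:
  assumes "c \<in> charts_at A p" "c' \<in> charts_at A p"
  shows "(chart_map c' \<circ> chart_inv c has_derivative
    frechet_derivative (chart_map c' \<circ> chart_inv c) (at (chart_map c p))) (at (chart_map c p))"
  using assms charts_compatible[of c c']
  by (intro has_derivative_frechet
      smooth_on_differentiable[where S = "chart_map c ` (chart_dom c \<inter> chart_dom c')"])
    (auto simp: charts_at_def)

lemma chart_inv_has_derivative_change:
  assumes "c \<in> charts_at A p" "c' \<in> charts_at A p"
    "(f \<circ> chart_inv c' has_derivative F) (at (chart_map c' p))"
  shows "(f \<circ> chart_inv c has_derivative
    (\<lambda>u. F (frechet_derivative (chart_map c' \<circ> chart_inv c) (at (chart_map c p)) u)))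
    (at (chart_map c p))"
proof -
  have p: "c \<in> A" "c' \<in> A" "p \<in> chart_dom c" "p \<in> chart_dom c'"
    using assms by (auto simp: charts_at_def)
  have "((f \<circ> chart_inv c') \<circ> (chart_map c' \<circ> chart_inv c) has_derivative
    F \<circ> frechet_derivative (chart_map c' \<circ> chart_inv c) (at (chart_map c p)))
    (at (chart_map c p))"
    using p assms by (intro diff_chain_at transition_has_derivative) auto
  then show ?thesis
    unfolding comp_def
    by (rule has_derivative_transform_within_open[OF _ chart_map_open_image[OF p(1), of "chart_dom c'"]])
       (use p chart_open in auto)
qed

lemma transition_cocycle:
  assumes "c \<in> charts_at A p" "c' \<in> charts_at A p" "c'' \<in> charts_at A p"
  shows "frechet_derivative (chart_map c'' \<circ> chart_inv c) (at (chart_map c p)) u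
    = frechet_derivative (chart_map c'' \<circ> chart_inv c') (at (chart_map c' p))
       (frechet_derivative (chart_map c' \<circ> chart_inv c) (at (chart_map c p)) u)"
  using frechet_derivative_at[OF chart_inv_has_derivative_change[OF assms(1,2)
      transition_has_derivative[OF assms(2,3)]], THEN fun_cong, of u] by simp

lemma transition_self:
  assumes "c \<in> charts_at A p"
  shows "frechet_derivative (chart_map c \<circ> chart_inv c) (at (chart_map c p)) u = u"
proof -
  have p: "c \<in> A" "p \<in> chart_dom c"
    using assms by (auto simp: charts_at_def)
  have "(chart_map c \<circ> chart_inv c has_derivative (\<lambda>u. u)) (at (chart_map c p))"
    by (rule has_derivative_transform_within_open[OF has_derivative_ident,
          of "chart_map c ` chart_dom c"])
       (use p chart_open in auto)
  from frechet_derivative_at[OF this, symmetric] show ?thesis by simp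
qed

lemma coord_vector_tangent:
  assumes "c \<in> charts_at A p"
  shows "coord_vector A c p u \<in> tangent_space A p"
proof -
  have "coord_vector A c p u c'' = frechet_derivative (chart_map c'' \<circ> chart_inv c')
      (at (chart_map c' p)) (coord_vector A c p u c')"
    if "c' \<in> charts_at A p" "c'' \<in> charts_at A p" for c' c''
    using transition_cocycle[OF assms that] that by (simp only: coord_vector_def if_True)
  moreover have "coord_vector A c p u c' = 0" if "c' \<notin> charts_at A p" for c'
    using that by (simp add: coord_vector_def)
  ultimately show ?thesis unfolding tangent_space_def by blast
qed

lemma coord_vector_self: "c \<in> charts_at A p \<Longrightarrow> coord_vector A c p u c = u"
  by (simp add: coord_vector_def transition_self)

text \<open>With \<open>coord_vector_self\<close>, this makes \<open>coord_vector A c p\<close> and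
  evaluation at \<open>c\<close> mutually inverse between \<open>'e\<close> and the tangent
  space.\<close>

lemma coord_vector_of_coord:
  assumes "v \<in> tangent_space A p" "c \<in> charts_at A p"
  shows "coord_vector A c p (v c) = v"
proof
  fix c'
  show "coord_vector A c p (v c) c' = v c'"
  proof (cases "c' \<in> charts_at A p")
    case True
    then have "v c' = frechet_derivative (chart_map c' \<circ> chart_inv c) (at (chart_map c p)) (v c)"
      using assms unfolding tangent_space_def by blast
    then show ?thesis using True by (simp add: coord_vector_def)
  next
    case False
    then have "v c' = 0" using assms unfolding tangent_space_def by blast
    then show ?thesis using False by (simp add: coord_vector_def)
  qed
qed

lemma lincomb_coord_vector:
  assumes "c \<in> charts_at A p"
  shows "lincomb a (coord_vector A c p u) b (coord_vector A c p w)
    = coord_vector A c p (a *\<^sub>R u + b *\<^sub>R w)"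
proof
  fix c'
  show "lincomb a (coord_vector A c p u) b (coord_vector A c p w) c'
    = coord_vector A c p (a *\<^sub>R u + b *\<^sub>R w) c'"
  proof (cases "c' \<in> charts_at A p")
    case True
    interpret bounded_linear "frechet_derivative (chart_map c' \<circ> chart_inv c) (at (chart_map c p))"
      by (rule has_derivative_bounded_linear[OF transition_has_derivative[OF assms True]])
    show ?thesis using True by (simp add: lincomb_def coord_vector_def add scaleR)
  qed (simp add: lincomb_def coord_vector_def)
qed

lemma lincomb_tangent:
  assumes "v \<in> tangent_space A p" "w \<in> tangent_space A p"
  shows "lincomb a v b w \<in> tangent_space A p"
proof -
  obtain c where c: "c \<in> charts_at A p" using charts_at_nonempty by blast
  show ?thesis
    using lincomb_coord_vector[OF c, of a "v c" b "w c"] coord_vector_tangent[OF c]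
    by (simp add: coord_vector_of_coord assms c)
qed

text \<open>In another chart the coefficients of such a field are a directional derivative of the
  transition map composed with the opposite transition map, so smoothness comes from the
  compatibility of charts. These fields serve as local frames and extend any given tangent
  vector.\<close>

lemma smooth_field_coord_vector:
  assumes "c \<in> A"
  shows "smooth_field_on A (chart_dom c) (\<lambda>q. coord_vector A c q w)"
  unfolding smooth_field_on_def
proof (intro conjI ballI)
  fix q assume "q \<in> chart_dom c"
  then show "coord_vector A c q w \<in> tangent_space A q"
    using assms by (intro coord_vector_tangent) (simp add: charts_at_def)
next
  fix c' assume c': "c' \<in> A"
  let ?S = "chart_map c' ` (chart_dom c \<inter> chart_dom c')"
  let ?F = "\<lambda>y. frechet_derivative (chart_map c' \<circ> chart_inv c) (at y) w"
  have S: "open ?S" using c' assms chart_open by (intro chart_map_open_image) auto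
  have "smooth_on ?S (\<lambda>x. ?F ((chart_map c \<circ> chart_inv c') x))"
  proof (rule smooth_on_compose[OF S, where T = "chart_map c ` (chart_dom c \<inter> chart_dom c')" and f = ?F])
    show "smooth_on (chart_map c ` (chart_dom c \<inter> chart_dom c')) ?F"
      using charts_compatible[OF assms c'] by (rule smooth_on_frechet)
    show "smooth_on ?S (chart_map c \<circ> chart_inv c')"
      using charts_compatible[OF c' assms] by (simp add: Int_commute)
  qed (use c' in auto)
  then show "smooth_on ?S (\<lambda>x. coord_vector A c (chart_inv c' x) w c')"
    by (subst smooth_on_cong[OF S, of _ "\<lambda>x. ?F ((chart_map c \<circ> chart_inv c') x)"])
      (use c' in \<open>auto simp: coord_vector_def charts_at_def\<close>)
qed

lemma smooth_field_near_coord_vector: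
  "c \<in> charts_at A p \<Longrightarrow> smooth_field_near A p (\<lambda>q. coord_vector A c q w)"
  unfolding smooth_field_near_def using charts_atD[of c p]
  by (intro exI[of _ "chart_dom c"]) (simp add: smooth_field_coord_vector chart_open)

lemma smooth_field_extension:
  assumes "v \<in> tangent_space A p"
  obtains X where "smooth_field_near A p X" "X p = v"
proof -
  obtain c where c: "c \<in> charts_at A p" using charts_at_nonempty by blast
  show thesis
    by (rule that[OF smooth_field_near_coord_vector[OF c, of "v c"] coord_vector_of_coord[OF assms c]])
qed

lemma smooth_field_near_tangent: "smooth_field_near A p X \<Longrightarrow> X p \<in> tangent_space A p"
  by (auto simp: smooth_field_near_def smooth_field_on_def)

text \<open>\<open>deriv_along\<close> rests on an arbitrary choice of chart; the chain rule removes
  it, so that derivatives can be computed in whichever chart is at hand.\<close>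

lemma smooth_fun_has_derivative:
  assumes c: "c \<in> charts_at A p" and "open U" "p \<in> U" "smooth_fun_on A U f"
  shows "(f \<circ> chart_inv c has_derivative (\<lambda>u. deriv_along A p (coord_vector A c p u) f))
    (at (chart_map c p))"
proof -
  define c0 where "c0 = (SOME c. c \<in> charts_at A p)"
  have c0: "c0 \<in> charts_at A p" unfolding c0_def by (rule someI[of "\<lambda>c. c \<in> charts_at A p", OF c])
  have "f \<circ> chart_inv c0 differentiable (at (chart_map c0 p))"
    using assms charts_atD[OF c0]
    by (intro smooth_on_differentiable[where S = "chart_map c0 ` (U \<inter> chart_dom c0)"])
      (auto simp: smooth_fun_on_def)
  note D = chart_inv_has_derivative_change[OF c c0 has_derivative_frechet[OF this]]
  show ?thesis
    by (rule has_derivative_eq_rhs[OF D])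
      (simp only: deriv_along_def Let_def c0_def[symmetric] coord_vector_def c0 if_True)
qed

end

section \<open>The Lee form is parallel for the Bismut connection\<close>

text \<open>The map \<open>L\<close> with \<open>inner (L x) y = G x y\<close> is injective by
  positivity, hence surjective in finite dimension; a preimage of the Euclidean gradient of
  \<open>f\<close> represents \<open>f\<close>. It is applied to the metric in a chart and also with
  \<open>inner\<close> in the role of \<open>G\<close>.\<close>

lemma bilinear_riesz:
  fixes G :: "'e::euclidean_space \<Rightarrow> 'e \<Rightarrow> real"
  assumes "bilinear G" "\<And>x. x \<noteq> 0 \<Longrightarrow> G x x > 0" "linear f"
  shows "\<exists>b. \<forall>x. f x = G b x"
proof -
  define L where "L x = (\<Sum>i\<in>Basis. G x i *\<^sub>R i)" for x
  have expand: "inner (\<Sum>i\<in>Basis. h i *\<^sub>R i) x = h x" if "linear h" for h :: "'e \<Rightarrow> real" and x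
  proof -
    have "h x = h (\<Sum>i\<in>Basis. inner x i *\<^sub>R i)" by (simp only: euclidean_representation)
    also have "\<dots> = (\<Sum>i\<in>Basis. inner x i * h i)"
      by (simp only: linear_sum[OF that] linear_scale[OF that] o_def real_scaleR_def)
    also have "\<dots> = inner (\<Sum>i\<in>Basis. h i *\<^sub>R i) x"
      unfolding inner_sum_left by (simp add: inner_commute mult.commute)
    finally show ?thesis by simp
  qed
  have G: "linear (G x)" for x using assms(1) by (simp add: bilinear_def)
  have L: "inner (L x) y = G x y" for x y unfolding L_def by (rule expand[OF G])
  have "linear L" unfolding L_def
    by (rule linearI) (simp_all add: bilinear_ladd[OF assms(1)] bilinear_lmul[OF assms(1)]
        scaleR_add_left sum.distrib scaleR_sum_right)
  moreover have "inj L"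
  proof -
    have "x = 0" if "L x = 0" for x
      using assms(2)[of x] L[of x x] that by force
    then show ?thesis using linear_injective_0[OF \<open>linear L\<close>] by blast
  qed
  ultimately have "surj L" by (rule linear_inj_imp_surj)
  then obtain b where "(\<Sum>i\<in>Basis. f i *\<^sub>R i) = L b" by (rule surjE)
  then have "f x = G b x" for x
    using expand[OF assms(3), of x] L[of b x] by simp
  then show ?thesis by blast
qed

lemma metric_parallelD:
  "metric_parallel A g D \<Longrightarrow> v \<in> tangent_space A p \<Longrightarrow> smooth_field_near A p Y \<Longrightarrow>
    smooth_field_near A p Z \<Longrightarrow>
    deriv_along A p v (\<lambda>q. g q (Y q) (Z q)) = g p (D p v Y) (Z p) + g p (Y p) (D p v Z)"
  unfolding metric_parallel_def by blast

lemma endo_parallelD: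
  "endo_parallel A J D \<Longrightarrow> v \<in> tangent_space A p \<Longrightarrow> smooth_field_near A p Y \<Longrightarrow>
    D p v (\<lambda>q. J q (Y q)) = J p (D p v Y)"
  unfolding endo_parallel_def by blast

lemma form_parallelD:
  "form_parallel A \<theta> D \<Longrightarrow> v \<in> tangent_space A p \<Longrightarrow> smooth_field_near A p Y \<Longrightarrow>
    deriv_along A p v (\<lambda>q. \<theta> q (Y q)) = \<theta> p (D p v Y)"
  unfolding form_parallel_def by blast

lemma skew_torsionD:
  assumes "skew_torsion A g D" "smooth_field_near A p X" "smooth_field_near A p Y"
    "smooth_field_near A p Z"
  shows "g p (torsion A D X Y p) (Z p) = - g p (torsion A D Y X p) (Z p)"
    and "g p (torsion A D X Y p) (Z p) = - g p (torsion A D X Z p) (Y p)"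
  using assms unfolding skew_torsion_def by blast+

section \<open>Tensors and the metric read in a chart\<close>

context smooth_manifold
begin

lemma linear_chart_form:
  assumes "c \<in> charts_at A p"
    and "\<And>u v a b. u \<in> tangent_space A p \<Longrightarrow> v \<in> tangent_space A p \<Longrightarrow>
      \<phi> (lincomb a u b v) = a * \<phi> u + b * \<phi> v"
  shows "linear (\<lambda>x. \<phi> (coord_vector A c p x) :: real)"
proof -
  have *: "\<phi> (coord_vector A c p (a *\<^sub>R x + b *\<^sub>R y))
      = a * \<phi> (coord_vector A c p x) + b * \<phi> (coord_vector A c p y)" for a b x y
    using assms by (simp flip: lincomb_coord_vector add: coord_vector_tangent)
  show ?thesis
    by (rule linearI) (use *[of 1 _ 1] *[of _ _ 0] in simp_all)
qed

lemma bilinear_chart_form: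
  assumes "c \<in> charts_at A p"
    and "\<And>u v w a b. u \<in> tangent_space A p \<Longrightarrow> v \<in> tangent_space A p \<Longrightarrow>
      w \<in> tangent_space A p \<Longrightarrow> \<beta> (lincomb a u b v) w = a * \<beta> u w + b * \<beta> v w"
    and "\<And>u v w a b. u \<in> tangent_space A p \<Longrightarrow> v \<in> tangent_space A p \<Longrightarrow>
      w \<in> tangent_space A p \<Longrightarrow> \<beta> w (lincomb a u b v) = a * \<beta> w u + b * \<beta> w v"
  shows "bilinear (\<lambda>x y. \<beta> (coord_vector A c p x) (coord_vector A c p y) :: real)"
  unfolding bilinear_def
  using linear_chart_form[OF assms(1), of "\<lambda>u. \<beta> u (coord_vector A c p _)"]
    linear_chart_form[OF assms(1), of "\<beta> (coord_vector A c p _)"]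
  by (simp add: assms coord_vector_tangent)

lemma smooth_1form_linear:
  "smooth_1form A \<theta> \<Longrightarrow> v \<in> tangent_space A p \<Longrightarrow> w \<in> tangent_space A p \<Longrightarrow>
    \<theta> p (lincomb a v b w) = a * \<theta> p v + b * \<theta> p w"
  unfolding smooth_1form_def by blast

lemma linear_1form_chart:
  assumes "smooth_1form A \<theta>" "c \<in> charts_at A p"
  shows "linear (\<lambda>x. \<theta> p (coord_vector A c p x))"
  using smooth_1form_linear[OF assms(1)] by (intro linear_chart_form[OF assms(2)]) auto

end

context riemannian_manifold
begin

lemma metric_linear_right:
  assumes "u \<in> tangent_space A p" "v \<in> tangent_space A p" "w \<in> tangent_space A p"
  shows "g p w (lincomb a u b v) = a * g p w u + b * g p w v"
proof -
  have "g p w (lincomb a u b v) = g p (lincomb a u b v) w"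
    by (intro metric_sym assms lincomb_tangent)
  then show ?thesis
    by (simp add: metric_linear assms metric_sym[OF assms(1,3)] metric_sym[OF assms(2,3)])
qed

lemma metric_diff:
  assumes "u \<in> tangent_space A p" "v \<in> tangent_space A p" "w \<in> tangent_space A p"
  shows "g p (\<lambda>c. u c - v c) w = g p u w - g p v w"
  using metric_linear[OF assms, of 1 "-1"] by (simp add: lincomb_def)

lemma metric_minus_left:
  assumes "u \<in> tangent_space A p" "w \<in> tangent_space A p"
  shows "g p (\<lambda>c. - u c) w = - g p u w"
  using metric_linear[OF assms(1,1,2), of "-1" 0] by (simp add: lincomb_def)

lemma metric_minus_right:
  assumes "u \<in> tangent_space A p" "w \<in> tangent_space A p"
  shows "g p u (\<lambda>c. - w c) = - g p u w"
  using metric_linear_right[OF assms(2,2,1), of "-1" 0] by (simp add: lincomb_def)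

lemma tangent_diff:
  "u \<in> tangent_space A p \<Longrightarrow> v \<in> tangent_space A p \<Longrightarrow> (\<lambda>c. u c - v c) \<in> tangent_space A p"
  using lincomb_tangent[of u p v 1 "-1"] by (simp add: lincomb_def)

lemma bilinear_metric:
  "c \<in> charts_at A p \<Longrightarrow>
    bilinear (\<lambda>x y. g p (coord_vector A c p x) (coord_vector A c p y))"
  by (rule bilinear_chart_form) (simp_all add: metric_linear metric_linear_right)

lemma metric_chart_pos:
  assumes "c \<in> charts_at A p" "x \<noteq> 0"
  shows "g p (coord_vector A c p x) (coord_vector A c p x) > 0"
proof (intro metric_pos coord_vector_tangent assms notI)
  assume "coord_vector A c p x = (\<lambda>c. 0)"
  then show False using coord_vector_self[OF assms(1), of x] assms(2) by simp
qed

lemma metric_riesz: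
  assumes "smooth_1form A \<theta>"
  obtains b where "b \<in> tangent_space A p" "\<And>v. v \<in> tangent_space A p \<Longrightarrow> \<theta> p v = g p b v"
proof -
  obtain c where c: "c \<in> charts_at A p" using charts_at_nonempty by blast
  from bilinear_riesz[OF bilinear_metric[OF c] metric_chart_pos[OF c] linear_1form_chart[OF assms c]]
  obtain x where x: "\<And>y. \<theta> p (coord_vector A c p y) = g p (coord_vector A c p x) (coord_vector A c p y)"
    by auto
  show thesis
  proof (rule that)
    show "coord_vector A c p x \<in> tangent_space A p" by (rule coord_vector_tangent[OF c])
    fix v assume "v \<in> tangent_space A p"
    then show "\<theta> p v = g p (coord_vector A c p x) v"
      using x[of "v c"] by (simp only: coord_vector_of_coord[OF _ c])
  qed
qed

lemma lie_bracket_levi_civita: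
  assumes "levi_civita_connection A g D" "smooth_field_near A p X" "smooth_field_near A p Y"
  shows "lie_bracket A X Y p = (\<lambda>c. D p (X p) Y c - D p (Y p) X c)"
proof -
  have "torsion A D X Y p = (\<lambda>c. 0)"
    using assms unfolding levi_civita_connection_def by blast
  then show ?thesis unfolding torsion_def by (metis eq_iff_diff_eq_0)
qed

end

lemma (in linear_connection) covariant_tangent:
  "smooth_field_near A p X \<Longrightarrow> smooth_field_near A p Y \<Longrightarrow> D p (X p) Y \<in> tangent_space A p"
  by (intro connection_tangent smooth_field_near_tangent)

text \<open>\<open>lie_bracket\<close> is defined chart by chart, and its transformation law would
  ask for the symmetry of second derivatives of transition maps. A torsion-free connection gives it
  at once, because the bracket is then a difference of covariant derivatives.\<close>

lemma (in riemannian_manifold) lie_bracket_tangent: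
  assumes "levi_civita_connection A g D" "smooth_field_near A p X" "smooth_field_near A p Y"
  shows "lie_bracket A X Y p \<in> tangent_space A p"
proof -
  interpret linear_connection A D
    using assms(1) by (simp add: levi_civita_connection_def)
  show ?thesis
    unfolding lie_bracket_levi_civita[OF assms]
    by (intro tangent_diff covariant_tangent assms)
qed

lemma (in riemannian_manifold) torsion_tangent:
  assumes "levi_civita_connection A g D0" "linear_connection A D"
    "smooth_field_near A p X" "smooth_field_near A p Y"
  shows "torsion A D X Y p \<in> tangent_space A p"
proof -
  interpret linear_connection A D by fact
  show ?thesis
    unfolding torsion_def
    by (intro tangent_diff covariant_tangent lie_bracket_tangent[OF assms(1)] assms)
qed

text \<open>Koszul's argument. Let \<open>S(X, Y, Z)\<close> be the difference of the two covariant
  derivatives, paired with \<open>Z\<close>. It is skew in \<open>Y, Z\<close> since both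
  connections are metric, and \<open>T(X, Y, Z) = S(X, Y, Z) - S(Y, X, Z)\<close>. Hence
  \<open>T(X, Y, Z) + T(Z, X, Y) - T(Y, Z, X)\<close> equals \<open>2 S(X, Y, Z)\<close>, and it
  equals \<open>T(X, Y, Z)\<close> when \<open>T\<close> is totally skew.\<close>

lemma (in riemannian_manifold) skew_torsion_difference:
  assumes LC: "levi_civita_connection A g D0"
    and D: "linear_connection A D" "metric_parallel A g D" "skew_torsion A g D"
    and near: "smooth_field_near A p X" "smooth_field_near A p Y" "smooth_field_near A p Z"
  shows "g p (torsion A D X Y p) (Z p) = 2 * (g p (D p (X p) Y) (Z p) - g p (D0 p (X p) Y) (Z p))"
proof -
  interpret D: linear_connection A D by fact
  interpret D0: linear_connection A D0
    using LC by (simp add: levi_civita_connection_def)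
  have D0: "metric_parallel A g D0" using LC by (simp add: levi_civita_connection_def)
  have metric: "g p (D p (U p) V) (W p) + g p (D p (U p) W) (V p)
      = g p (D0 p (U p) V) (W p) + g p (D0 p (U p) W) (V p)"
    if "smooth_field_near A p U" "smooth_field_near A p V" "smooth_field_near A p W" for U V W
  proof -
    have "U p \<in> tangent_space A p" using that by (intro smooth_field_near_tangent)
    then have "g p (D p (U p) V) (W p) + g p (V p) (D p (U p) W)
      = g p (D0 p (U p) V) (W p) + g p (V p) (D0 p (U p) W)"
      using metric_parallelD[OF D(2) _ that(2,3)] metric_parallelD[OF D0 _ that(2,3)] by simp
    moreover have "g p (V p) (D p (U p) W) = g p (D p (U p) W) (V p)"
      "g p (V p) (D0 p (U p) W) = g p (D0 p (U p) W) (V p)"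
      by (intro metric_sym smooth_field_near_tangent D.covariant_tangent D0.covariant_tangent that)+
    ultimately show ?thesis by simp
  qed
  have tor: "g p (torsion A D U V p) (W p) = g p (D p (U p) V) (W p) - g p (D p (V p) U) (W p)
      - (g p (D0 p (U p) V) (W p) - g p (D0 p (V p) U) (W p))"
    if "smooth_field_near A p U" "smooth_field_near A p V" "smooth_field_near A p W" for U V W
    unfolding torsion_def lie_bracket_levi_civita[OF LC that(1,2)]
    by (subst metric_diff metric_diff metric_diff; (intro tangent_diff smooth_field_near_tangent
          D.covariant_tangent D0.covariant_tangent that refl)?)+
  note skew = skew_torsionD[OF D(3)]
  note s = near
  show ?thesis
    using metric[OF s] metric[OF s(2,3,1)] metric[OF s(3,1,2)]
      tor[OF s] tor[OF s(2,3,1)] tor[OF s(3,1,2)]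
      skew[OF s] skew[OF s(2,3,1)] skew[OF s(3,1,2)]
    by argo
qed

section \<open>Torsion of a Hermitian connection\<close>

context hermitian_manifold
begin

lemma J_diff:
  assumes "u \<in> tangent_space A p" "v \<in> tangent_space A p"
  shows "J p (\<lambda>c. u c - v c) = (\<lambda>c. J p u c - J p v c)"
  using J_linear[OF assms, of 1 "-1"] by (simp add: lincomb_def)

lemma J_near:
  assumes "smooth_field_near A p X"
  shows "smooth_field_near A p (\<lambda>q. J q (X q))"
  using assms J_smooth unfolding smooth_field_near_def by blast

lemma metric_J_left:
  assumes "u \<in> tangent_space A p" "v \<in> tangent_space A p"
  shows "g p (J p u) v = - g p u (J p v)"
proof -
  have "g p (J p u) v = g p (J p (J p u)) (J p v)"
    using assms by (intro hermitian[symmetric] J_tangent)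
  then show ?thesis by (simp add: J_square J_tangent metric_minus_left assms)
qed

text \<open>Substitute \<open>[U, V] = D_U V - D_V U - T(U, V)\<close> into the vanishing of the
  Nijenhuis tensor. As \<open>D\<close> commutes with \<open>J\<close>, all covariant derivatives
  cancel and the identity passes to \<open>T\<close>.\<close>

lemma nijenhuis_torsion:
  assumes LC: "levi_civita_connection A g D0"
    and D: "linear_connection A D" "endo_parallel A J D"
    and near: "smooth_field_near A p X" "smooth_field_near A p Y"
  shows "torsion A D (\<lambda>q. J q (X q)) (\<lambda>q. J q (Y q)) p c
    = torsion A D X Y p c + J p (torsion A D (\<lambda>q. J q (X q)) Y p) c
      + J p (torsion A D X (\<lambda>q. J q (Y q)) p) c"
proof -
  interpret D: linear_connection A D by fact
  note J = near[THEN J_near]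
  have J_torsion: "J p (torsion A D U V p) c
      = J p (D p (U p) V) c - J p (D p (V p) U) c - J p (lie_bracket A U V p) c"
    if "smooth_field_near A p U" "smooth_field_near A p V" for U V
    unfolding torsion_def
    by (simp add: J_diff tangent_diff D.covariant_tangent lie_bracket_tangent[OF LC] that)
  have D_J: "D p (U p) (\<lambda>q. J q (V q)) = J p (D p (U p) V)"
    if "smooth_field_near A p U" "smooth_field_near A p V" for U V
    by (intro endo_parallelD[OF D(2)] smooth_field_near_tangent that)
  have J_J: "J p (J p (D p (U p) V)) c = - D p (U p) V c"
    if "smooth_field_near A p U" "smooth_field_near A p V" for U V
    by (simp add: J_square D.covariant_tangent that)
  show ?thesis
    using J_integrable[OF near, of c]
    unfolding J_torsion[OF J(1) near(2)] J_torsion[OF near(1) J(2)]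
    unfolding torsion_def D_J[OF near(1,2)] D_J[OF near(2,1)] D_J[OF J(1) near(2)]
      D_J[OF J(2) near(1)] J_J[OF near(1,2)] J_J[OF near(2,1)]
    by (simp add: algebra_simps)
qed

text \<open>The same substitution in \<open>d\<omega>\<close>. Since \<omega> is parallel, what
  survives is the sum of \<open>\<omega>(T(X, Y), Z)\<close> over cyclic permutations; moving
  \<open>J\<close> to the second slot of \<open>g\<close> produces the sign.\<close>

lemma ext_deriv_fundamental_form:
  assumes LC: "levi_civita_connection A g D0"
    and D: "linear_connection A D" "metric_parallel A g D" "endo_parallel A J D"
    and near: "smooth_field_near A p X" "smooth_field_near A p Y" "smooth_field_near A p Z"
  shows "ext_deriv2 A (fundamental_form J g) p X Y Z
    = - (g p (torsion A D X Y p) (J p (Z p)) + g p (torsion A D Y Z p) (J p (X p))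
         + g p (torsion A D Z X p) (J p (Y p)))"
proof -
  interpret D: linear_connection A D by fact
  have deriv: "deriv_along A p (U p) (\<lambda>q. g q (J q (V q)) (W q))
      = - g p (D p (U p) V) (J p (W p)) + g p (D p (U p) W) (J p (V p))"
    if s: "smooth_field_near A p U" "smooth_field_near A p V" "smooth_field_near A p W" for U V W
  proof -
    note t = s[THEN smooth_field_near_tangent]
    show ?thesis
      using metric_parallelD[OF D(2) t(1) J_near[OF s(2)] s(3)]
        endo_parallelD[OF D(3) t(1) s(2)]
        metric_J_left[OF D.covariant_tangent[OF s(1,2)] t(3)]
        metric_sym[OF J_tangent[OF t(2)] D.covariant_tangent[OF s(1,3)]]
      by simp
  qed
  have bracket: "g p (J p (lie_bracket A U V p)) (W p)
      = - g p (D p (U p) V) (J p (W p)) + g p (D p (V p) U) (J p (W p))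
        + g p (torsion A D U V p) (J p (W p))"
    if s: "smooth_field_near A p U" "smooth_field_near A p V" "smooth_field_near A p W" for U V W
  proof -
    note t = s[THEN smooth_field_near_tangent]
    have "g p (torsion A D U V p) (J p (W p)) = g p (D p (U p) V) (J p (W p))
        - g p (D p (V p) U) (J p (W p)) - g p (lie_bracket A U V p) (J p (W p))"
      unfolding torsion_def
      by (simp add: metric_diff tangent_diff D.covariant_tangent lie_bracket_tangent[OF LC] s
          J_tangent t)
    then show ?thesis
      using metric_J_left[OF lie_bracket_tangent[OF LC s(1,2)] t(3)] by simp
  qed
  note s = near
  show ?thesis
    unfolding ext_deriv2_def fundamental_form_def
    using deriv[OF s] deriv[OF s(2,3,1)] deriv[OF s(3,1,2)]
      bracket[OF s] bracket[OF s(2,3,1)] bracket[OF s(3,1,2)]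
    by simp
qed

text \<open>Pairing the Nijenhuis identity with \<open>Z\<close> gives
  \<open>T(X, Y, Z) = T(JX, JY, Z) + T(JX, Y, JZ) + T(X, JY, JZ)\<close>. On the other side
  \<open>J^2 = -1\<close> cancels the sign, so \<open>d\<omega>(JX, JY, JZ)\<close> is
  \<open>T(JX, JY, Z) + T(JY, JZ, X) + T(JZ, JX, Y)\<close>. Cyclic invariance of \<open>T\<close>
  matches the terms.\<close>

lemma bismut_torsion:
  assumes LC: "levi_civita_connection A g D0"
    and D: "bismut_connection A J g D"
    and near: "smooth_field_near A p X" "smooth_field_near A p Y" "smooth_field_near A p Z"
  shows "g p (torsion A D X Y p) (Z p)
    = ext_deriv2 A (fundamental_form J g) p
        (\<lambda>q. J q (X q)) (\<lambda>q. J q (Y q)) (\<lambda>q. J q (Z q))"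
proof -
  have D': "linear_connection A D" "metric_parallel A g D" "endo_parallel A J D"
    "skew_torsion A g D"
    using D by (auto simp: bismut_connection_def)
  note s = near and J = near[THEN J_near] and t = near[THEN smooth_field_near_tangent]
  let ?J = "\<lambda>X q. J q (X q)"
  let ?T = "\<lambda>X Y Z. g p (torsion A D X Y p) (Z p)"
  note tor = torsion_tangent[OF LC D'(1)]
  have JJ: "g p (torsion A D U V p) (J p (J p w)) = - g p (torsion A D U V p) w"
    if "smooth_field_near A p U" "smooth_field_near A p V" "w \<in> tangent_space A p" for U V w
    using that by (simp add: J_square metric_minus_right tor)
  have cyclic: "?T U V W = ?T V W U"
    if "smooth_field_near A p U" "smooth_field_near A p V" "smooth_field_near A p W" for U V W
    using skew_torsionD[OF D'(4) that] skew_torsionD[OF D'(4) that(2,1,3)] by simp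
  have d: "ext_deriv2 A (fundamental_form J g) p (?J X) (?J Y) (?J Z)
      = ?T (?J X) (?J Y) Z + ?T (?J Y) (?J Z) X + ?T (?J Z) (?J X) Y"
    using ext_deriv_fundamental_form[OF LC D'(1,2,3) J]
      JJ[OF J(1,2) t(3)] JJ[OF J(2,3) t(1)] JJ[OF J(3,1) t(2)] by simp
  have N: "torsion A D X Y p = (\<lambda>c. torsion A D (?J X) (?J Y) p c
      - J p (torsion A D (?J X) Y p) c - J p (torsion A D X (?J Y) p) c)"
    using nijenhuis_torsion[OF LC D'(1,3) s(1,2)] by (simp add: fun_eq_iff)
  have "?T X Y Z = ?T (?J X) (?J Y) Z - g p (J p (torsion A D (?J X) Y p)) (Z p)
      - g p (J p (torsion A D X (?J Y) p)) (Z p)"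
    by (subst N) (simp add: metric_diff tangent_diff tor J_tangent s J t)
  moreover have "g p (J p (torsion A D (?J X) Y p)) (Z p) = - ?T (?J X) Y (?J Z)"
    by (intro metric_J_left tor J s t)
  moreover have "g p (J p (torsion A D X (?J Y) p)) (Z p) = - ?T X (?J Y) (?J Z)"
    by (intro metric_J_left tor J s t)
  ultimately show ?thesis
    using d cyclic[OF s(1) J(2,3)] cyclic[OF J(3,1) s(2)] by simp
qed

end

lemma (in vaisman_manifold) lee_form_bismut_parallel:
  assumes D: "bismut_connection A J g D"
  shows "form_parallel A \<theta> D"
  unfolding form_parallel_def
proof (intro allI ballI impI)
  fix p Y v assume v: "v \<in> tangent_space A p" and Y: "smooth_field_near A p Y"
  obtain D0 where LC: "levi_civita_connection A g D0" and D0: "form_parallel A \<theta> D0"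
    using lee_parallel by blast
  have D': "linear_connection A D" "metric_parallel A g D" "skew_torsion A g D"
    using D by (auto simp: bismut_connection_def)
  interpret D: linear_connection A D by fact
  interpret D0: linear_connection A D0 using LC by (simp add: levi_civita_connection_def)
  obtain b where b: "b \<in> tangent_space A p"
    and \<theta>: "\<And>u. u \<in> tangent_space A p \<Longrightarrow> \<theta> p u = g p b u"
    using metric_riesz[OF lee_form] by blast
  obtain X where X: "smooth_field_near A p X" "X p = v" using smooth_field_extension[OF v] by blast
  obtain Z where Z: "smooth_field_near A p Z" "Z p = b" using smooth_field_extension[OF b] by blast
  note s = X(1) Y Z(1)
  note J = s[THEN J_near] and t = s[THEN smooth_field_near_tangent]
  \<comment> \<open>Of the three terms of \<open>\<theta> \<and> \<omega>\<close> on
    \<open>JX, JY, Jb\<close>, one contains \<open>\<theta>(Jb) = g(b, Jb) = 0\<close>. By the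
    identities \<open>1\<close> and \<open>2\<close> the other two are
    \<open>\<theta>(JX) \<theta>(JY)\<close> with opposite signs.\<close>
  have JZ: "\<theta> p (J p b) = 0"
    using metric_J_left[OF b b] metric_sym[OF b J_tangent[OF b]] \<theta>[OF J_tangent[OF b]] by simp
  have 1: "g p (J p (J p (Y p))) (J p b) = \<theta> p (J p (Y p))"
    using hermitian[OF J_tangent[OF t(2)] b] metric_sym[OF J_tangent[OF t(2)] b]
      \<theta>[OF J_tangent[OF t(2)]] by simp
  have 2: "g p (J p (J p b)) (J p (X p)) = - \<theta> p (J p (X p))"
    using \<theta>[OF J_tangent[OF t(1)]] by (simp add: J_square b metric_minus_left J_tangent t)
  have "g p (torsion A D X Y p) (Z p) = 0"
    using bismut_torsion[OF LC D s] lck[OF J]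
    by (simp add: wedge12_def fundamental_form_def Z(2) JZ 1 2)
  then have "g p (D p (X p) Y) b = g p (D0 p (X p) Y) b"
    using skew_torsion_difference[OF LC D' s] Z(2) by simp
  then have "\<theta> p (D p (X p) Y) = \<theta> p (D0 p (X p) Y)"
    using \<theta> metric_sym[OF _ b] D.covariant_tangent[OF s(1,2)] D0.covariant_tangent[OF s(1,2)]
    by simp
  then show "deriv_along A p v (\<lambda>q. \<theta> q (Y q)) = \<theta> p (D p v Y)"
    using form_parallelD[OF D0 v Y] X(2) by simp
qed

section \<open>Parallel tensors are constant along parallel vector fields\<close>

lemma bilinear_expand:
  fixes B :: "'e::euclidean_space \<Rightarrow> 'f::euclidean_space \<Rightarrow> real"
  assumes "bilinear B"
  shows "B u w = (\<Sum>(i,j)\<in>Basis \<times> Basis. inner u i * inner w j * B i j)"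
proof -
  have "B (\<Sum>i\<in>Basis. inner u i *\<^sub>R i) (\<Sum>j\<in>Basis. inner w j *\<^sub>R j)
    = (\<Sum>(i,j)\<in>Basis \<times> Basis. B (inner u i *\<^sub>R i) (inner w j *\<^sub>R j))"
    by (rule bilinear_sum[OF assms])
  also have "\<dots> = (\<Sum>(i,j)\<in>Basis \<times> Basis. inner u i * inner w j * B i j)"
    by (intro sum.cong) (auto simp: bilinear_lmul[OF assms] bilinear_rmul[OF assms])
  finally show ?thesis by (simp only: euclidean_representation)
qed

text \<open>The product rule for a bilinear form that varies with the base point. Only the
  derivative of \<open>B y u w\<close> for fixed \<open>u, w\<close> is known; expansion over
  \<open>Basis\<close> reduces moving arguments to finitely many such functions. Bilinearity is
  available on \<open>S\<close> alone, whence the restriction to times within \<open>d\<close> of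
  \<open>t\<close>.\<close>

lemma bilinear_family_derivative:
  fixes B :: "'x::euclidean_space \<Rightarrow> 'e::euclidean_space \<Rightarrow> 'f::euclidean_space \<Rightarrow> real"
  assumes bil: "\<And>y. y \<in> S \<Longrightarrow> bilinear (B y)" and S: "open S"
    and B': "\<And>u w. ((\<lambda>y. B y u w) has_derivative B' u w) (at (x t))"
    and x: "(x has_vector_derivative x') (at t within T)"
    and V: "(V has_vector_derivative V') (at t within T)"
    and W: "(W has_vector_derivative W') (at t within T)"
    and t: "t \<in> T" and d: "d > 0" and xS: "\<And>s. s \<in> T \<Longrightarrow> dist s t < d \<Longrightarrow> x s \<in> S"
  shows "((\<lambda>s. B (x s) (V s) (W s)) has_real_derivative
    B' (V t) (W t) x' + B (x t) V' (W t) + B (x t) (V t) W') (at t within T)"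
proof -
  have xt: "x t \<in> S" using xS t d by simp
  let ?BB = "Basis \<times> Basis :: ('e \<times> 'f) set"
  have "((\<lambda>y. \<Sum>(i,j)\<in>?BB. inner (V t) i * inner (W t) j * B y i j) has_derivative
      (\<lambda>h. \<Sum>(i,j)\<in>?BB. inner (V t) i * inner (W t) j * B' i j h)) (at (x t))"
    unfolding case_prod_beta by (intro has_derivative_sum has_derivative_mult_right B')
  then have "((\<lambda>y. B y (V t) (W t)) has_derivative
      (\<lambda>h. \<Sum>(i,j)\<in>?BB. inner (V t) i * inner (W t) j * B' i j h)) (at (x t))"
    by (rule has_derivative_transform_within_open[OF _ S xt]) (rule bilinear_expand[OF bil, symmetric])
  \<comment> \<open>Uniqueness of the derivative supplies the expansion of \<open>B'\<close> in its
    two vector arguments from that of \<open>B\<close>.\<close>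
  from has_derivative_unique[OF B' this]
  have B'_expand: "B' (V t) (W t) x'
      = (\<Sum>(i,j)\<in>?BB. inner (V t) i * inner (W t) j * B' i j x')" by simp
  have V_deriv: "((\<lambda>s. inner (V s) i) has_real_derivative inner V' i) (at t within T)" for i
    unfolding has_real_derivative_iff_has_vector_derivative
    by (rule bounded_linear.has_vector_derivative[OF bounded_linear_inner_left V])
  have W_deriv: "((\<lambda>s. inner (W s) i) has_real_derivative inner W' i) (at t within T)" for i
    unfolding has_real_derivative_iff_has_vector_derivative
    by (rule bounded_linear.has_vector_derivative[OF bounded_linear_inner_left W])
  have x_deriv: "((\<lambda>s. B (x s) i j) has_real_derivative B' i j x') (at t within T)" for i j
    unfolding has_real_derivative_iff_has_vector_derivative
    using vector_derivative_diff_chain_within[OF x has_derivative_at_withinI[OF B']]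
    by (simp add: comp_def)
  have "((\<lambda>s. \<Sum>(i,j)\<in>?BB. inner (V s) i * inner (W s) j * B (x s) i j) has_real_derivative
      (\<Sum>(i,j)\<in>?BB. inner (V t) i * inner (W t) j * B' i j x'
        + inner V' i * inner (W t) j * B (x t) i j + inner (V t) i * inner W' j * B (x t) i j))
      (at t within T)"
    unfolding case_prod_beta
    by (rule DERIV_sum)
      (auto intro!: derivative_eq_intros V_deriv W_deriv x_deriv simp: algebra_simps)
  also have "(\<Sum>(i,j)\<in>?BB. inner (V t) i * inner (W t) j * B' i j x'
        + inner V' i * inner (W t) j * B (x t) i j + inner (V t) i * inner W' j * B (x t) i j)
      = B' (V t) (W t) x' + B (x t) V' (W t) + B (x t) (V t) W'"
    unfolding B'_expand bilinear_expand[OF bil[OF xt], of V'] bilinear_expand[OF bil[OF xt], of _ W']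
    by (simp add: sum.distrib case_prod_beta)
  finally show ?thesis
    by (rule has_field_derivative_transform_within[OF _ d t])
      (rule bilinear_expand[OF bil[OF xS], symmetric])
qed

lemma piecewise_constant:
  fixes h :: "real \<Rightarrow> real" and \<tau> :: "nat \<Rightarrow> real"
  assumes "\<And>i. i < N \<Longrightarrow> \<tau> i < \<tau> (Suc i)"
    and "\<And>i t. i < N \<Longrightarrow> t \<in> {\<tau> i..\<tau> (Suc i)} \<Longrightarrow>
      (h has_real_derivative 0) (at t within {\<tau> i..\<tau> (Suc i)})"
  shows "h (\<tau> N) = h (\<tau> 0)"
  using assms
proof (induction N)
  case (Suc N)
  obtain k where "\<forall>t\<in>{\<tau> N..\<tau> (Suc N)}. h t = k"
    using has_field_derivative_zero_constant[of "{\<tau> N..\<tau> (Suc N)}" h] Suc.prems(2)[of N] by auto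
  then have "h (\<tau> (Suc N)) = h (\<tau> N)" using Suc.prems(1)[of N] by simp
  then show ?case using Suc by simp
qed simp

lemma (in smooth_manifold) smooth_curve_chart:
  assumes "smooth_curve A \<gamma> a b" "a < b" "t \<in> {a..b}" "c \<in> charts_at A (\<gamma> t)"
  shows "\<exists>d>0. \<forall>s\<in>{a..b}. dist s t < d \<longrightarrow> \<gamma> s \<in> chart_dom c"
    and "((\<lambda>s. chart_map c (\<gamma> s)) has_vector_derivative
      vector_derivative (\<lambda>s. chart_map c (\<gamma> s)) (at t within {a..b})) (at t within {a..b})"
proof -
  obtain I \<delta> where I: "open I" "{a..b} \<subseteq> I" "continuous_on I \<delta>" "\<forall>t\<in>{a..b}. \<delta> t = \<gamma> t"
    and smooth: "\<forall>c\<in>A. smooth_on {t \<in> I. \<delta> t \<in> chart_dom c} (chart_map c \<circ> \<delta>)"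
    using assms(1) unfolding smooth_curve_def by blast
  have c: "c \<in> A" "\<gamma> t \<in> chart_dom c" using charts_atD[OF assms(4)] by auto
  have "open (I \<inter> \<delta> -` chart_dom c)"
    using continuous_open_preimage[OF I(3,1)] chart_open c by blast
  moreover have t: "t \<in> I \<inter> \<delta> -` chart_dom c" using assms(3) I c by auto
  ultimately obtain d where d: "d > 0" "ball t d \<subseteq> I \<inter> \<delta> -` chart_dom c"
    using open_contains_ball by metis
  have "chart_map c \<circ> \<delta> differentiable (at t)"
    by (rule smooth_on_differentiable[OF bspec[OF smooth c(1)]]) (use t in auto)
  then obtain x' where "((chart_map c \<circ> \<delta>) has_vector_derivative x') (at t)"
    using vector_derivative_works by blast
  then have "((chart_map c \<circ> \<delta>) has_vector_derivative x') (at t within {a..b})"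
    by (rule has_vector_derivative_at_within)
  \<comment> \<open>The curve and its extension agree on all of \<open>{a..b}\<close>, so any radius
    would do.\<close>
  then have x': "((\<lambda>s. chart_map c (\<gamma> s)) has_vector_derivative x') (at t within {a..b})"
    by (rule has_vector_derivative_transform_within[where d = 1]) (use assms(3) I(4) in auto)
  have "\<forall>s\<in>{a..b}. dist s t < d \<longrightarrow> \<gamma> s \<in> chart_dom c"
    using d(2) I(4) by (auto simp: dist_commute subset_iff)
  then show "\<exists>d>0. \<forall>s\<in>{a..b}. dist s t < d \<longrightarrow> \<gamma> s \<in> chart_dom c" using d(1) by blast
  show "((\<lambda>s. chart_map c (\<gamma> s)) has_vector_derivative
      vector_derivative (\<lambda>s. chart_map c (\<gamma> s)) (at t within {a..b})) (at t within {a..b})"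
    using x' vector_derivative_within_closed_interval[OF assms(2,3) x'] by simp
qed

section \<open>Invariance of parallel tensors along curves and under holonomy\<close>

context linear_connection
begin

lemma coord_vector_christoffel:
  assumes "c \<in> charts_at A p"
  shows "D p (coord_vector A c p u) (\<lambda>q. coord_vector A c q w)
    = coord_vector A c p (christoffel A D c p u w)"
  unfolding christoffel_def
  by (intro coord_vector_of_coord[symmetric] connection_tangent coord_vector_tangent
      smooth_field_near_coord_vector assms)

lemma smooth_fun_chart_derivative:
  assumes "c \<in> charts_at A p" "smooth_fun_on A (chart_dom c) f"
  shows "((\<lambda>y. f (chart_inv c y)) has_derivative
    (\<lambda>h. deriv_along A p (coord_vector A c p h) f)) (at (chart_map c p))"
  using smooth_fun_has_derivative[OF assms(1) _ _ assms(2)] charts_atD[OF assms(1)] chart_open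
  by (simp add: comp_def)

text \<open>In a chart the derivative of the form in the base direction \<open>h\<close> is
  \<open>B(\<Gamma>(h, u), w) + B(u, \<Gamma>(h, w))\<close>, while
  \<open>V' = - \<Gamma>(x', V)\<close> for a parallel field, so the product rule sums to 0. The
  predicate \<open>metric_parallel\<close> is applied to an arbitrary bilinear
  \<open>\<beta>\<close>, as the result serves both \<open>g\<close> and \<omega>.\<close>

lemma parallel_bilinear_derivative_zero:
  assumes add_left: "\<And>p u v w a b. u \<in> tangent_space A p \<Longrightarrow> v \<in> tangent_space A p \<Longrightarrow>
      w \<in> tangent_space A p \<Longrightarrow> \<beta> p (lincomb a u b v) w = a * \<beta> p u w + b * \<beta> p v w"
    and add_right: "\<And>p u v w a b. u \<in> tangent_space A p \<Longrightarrow> v \<in> tangent_space A p \<Longrightarrow>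
      w \<in> tangent_space A p \<Longrightarrow> \<beta> p w (lincomb a u b v) = a * \<beta> p w u + b * \<beta> p w v"
    and smooth: "\<And>U X Y. open U \<Longrightarrow> smooth_field_on A U X \<Longrightarrow> smooth_field_on A U Y \<Longrightarrow>
      smooth_fun_on A U (\<lambda>p. \<beta> p (X p) (Y p))"
    and parallel: "metric_parallel A \<beta> D"
    and \<gamma>: "smooth_curve A \<gamma> a b" "a < b" "t \<in> {a..b}"
    and V: "parallel_along A D \<gamma> V a b" and W: "parallel_along A D \<gamma> W a b"
  shows "((\<lambda>s. \<beta> (\<gamma> s) (V s) (W s)) has_real_derivative 0) (at t within {a..b})"
proof -
  obtain c where c: "c \<in> charts_at A (\<gamma> t)" using charts_at_nonempty by blast
  note cA = charts_atD[OF c]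
  note x' = smooth_curve_chart(2)[OF \<gamma> c]
  obtain d where d: "d > 0" "\<And>s. s \<in> {a..b} \<Longrightarrow> dist s t < d \<Longrightarrow> \<gamma> s \<in> chart_dom c"
    using smooth_curve_chart(1)[OF \<gamma> c] by blast
  let ?x' = "vector_derivative (\<lambda>s. chart_map c (\<gamma> s)) (at t within {a..b})"
  let ?\<Gamma> = "christoffel A D c (\<gamma> t)"
  let ?S = "chart_map c ` chart_dom c"
  define B where "B y u w = \<beta> (chart_inv c y) (coord_vector A c (chart_inv c y) u)
    (coord_vector A c (chart_inv c y) w)" for y u w
  define B' where "B' u w h = B (chart_map c (\<gamma> t)) (?\<Gamma> h u) w + B (chart_map c (\<gamma> t)) u (?\<Gamma> h w)"
    for u w h
  have bil: "bilinear (B y)" if "y \<in> ?S" for y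
  proof -
    have "c \<in> charts_at A (chart_inv c y)" using that cA by (auto simp: charts_at_def)
    then show ?thesis unfolding B_def using add_left add_right by (intro bilinear_chart_form) auto
  qed
  have B': "((\<lambda>y. B y u w) has_derivative B' u w) (at (chart_map c (\<gamma> t)))" for u w
  proof -
    have "smooth_fun_on A (chart_dom c) (\<lambda>q. \<beta> q (coord_vector A c q u) (coord_vector A c q w))"
      using cA chart_open by (intro smooth smooth_field_coord_vector) auto
    from smooth_fun_chart_derivative[OF c this] show ?thesis
      unfolding B_def B'_def
      using metric_parallelD[OF parallel coord_vector_tangent[OF c]
        smooth_field_near_coord_vector[OF c, of u] smooth_field_near_coord_vector[OF c, of w]]
      by (simp add: coord_vector_christoffel[OF c] cA)
  qed
  have V': "((\<lambda>s. V s c) has_vector_derivative - ?\<Gamma> ?x' (V t c)) (at t within {a..b})"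
    "((\<lambda>s. W s c) has_vector_derivative - ?\<Gamma> ?x' (W t c)) (at t within {a..b})"
    using V W \<gamma>(3) c unfolding parallel_along_def by blast+
  have "((\<lambda>s. B (chart_map c (\<gamma> s)) (V s c) (W s c)) has_real_derivative
      B' (V t c) (W t c) ?x' + B (chart_map c (\<gamma> t)) (- ?\<Gamma> ?x' (V t c)) (W t c)
        + B (chart_map c (\<gamma> t)) (V t c) (- ?\<Gamma> ?x' (W t c))) (at t within {a..b})"
    by (rule bilinear_family_derivative[OF bil _ B' x' V' \<gamma>(3) d(1)])
      (use cA chart_open d(2) in auto)
  also have "B' (V t c) (W t c) ?x' + B (chart_map c (\<gamma> t)) (- ?\<Gamma> ?x' (V t c)) (W t c)
        + B (chart_map c (\<gamma> t)) (V t c) (- ?\<Gamma> ?x' (W t c)) = 0"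
    using bilinear_lneg[OF bil] bilinear_rneg[OF bil] cA by (simp add: B'_def)
  finally show ?thesis
  proof (rule has_field_derivative_transform_within[OF _ d(1) \<gamma>(3)])
    fix s assume s: "s \<in> {a..b}" "dist s t < d"
    have cs: "c \<in> charts_at A (\<gamma> s)" using d(2)[OF s] cA by (simp add: charts_at_def)
    have "V s \<in> tangent_space A (\<gamma> s)" "W s \<in> tangent_space A (\<gamma> s)"
      using V W s(1) unfolding parallel_along_def by blast+
    then show "B (chart_map c (\<gamma> s)) (V s c) (W s c) = \<beta> (\<gamma> s) (V s) (W s)"
      using d(2)[OF s] cA by (simp add: B_def coord_vector_of_coord[OF _ cs])
  qed
qed

lemma parallel_form_derivative_zero:
  assumes \<theta>: "smooth_1form A \<theta>" and parallel: "form_parallel A \<theta> D"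
    and \<gamma>: "smooth_curve A \<gamma> a b" "a < b" "t \<in> {a..b}"
    and V: "parallel_along A D \<gamma> V a b"
  shows "((\<lambda>s. \<theta> (\<gamma> s) (V s)) has_real_derivative 0) (at t within {a..b})"
proof -
  obtain c where c: "c \<in> charts_at A (\<gamma> t)" using charts_at_nonempty by blast
  note cA = charts_atD[OF c]
  note x' = smooth_curve_chart(2)[OF \<gamma> c]
  obtain d where d: "d > 0" "\<And>s. s \<in> {a..b} \<Longrightarrow> dist s t < d \<Longrightarrow> \<gamma> s \<in> chart_dom c"
    using smooth_curve_chart(1)[OF \<gamma> c] by blast
  let ?x' = "vector_derivative (\<lambda>s. chart_map c (\<gamma> s)) (at t within {a..b})"
  let ?\<Gamma> = "christoffel A D c (\<gamma> t)"
  let ?S = "chart_map c ` chart_dom c"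
  \<comment> \<open>A dummy real factor, later held at \<open>1\<close>, turns the one-form into a
    bilinear form, so that \<open>bilinear_family_derivative\<close> covers this case as
    well.\<close>
  define B where "B y u r = \<theta> (chart_inv c y) (coord_vector A c (chart_inv c y) u) * r"
    for y u and r :: real
  define B' where "B' u r h = B (chart_map c (\<gamma> t)) (?\<Gamma> h u) r" for u r h
  have bil: "bilinear (B y)" if "y \<in> ?S" for y
  proof -
    have "c \<in> charts_at A (chart_inv c y)" using that cA by (auto simp: charts_at_def)
    note lin = linear_1form_chart[OF \<theta> this]
    show ?thesis unfolding B_def bilinear_def
      using linear_add[OF lin] linear_scale[OF lin]
      by (auto intro!: linearI simp: algebra_simps)
  qed
  have B': "((\<lambda>y. B y u r) has_derivative B' u r) (at (chart_map c (\<gamma> t)))" for u r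
  proof -
    have "smooth_fun_on A (chart_dom c) (\<lambda>q. \<theta> q (coord_vector A c q u))"
      using \<theta> cA chart_open smooth_field_coord_vector[of c u] unfolding smooth_1form_def by blast
    from smooth_fun_chart_derivative[OF c this] show ?thesis
      unfolding B_def B'_def
      using form_parallelD[OF parallel coord_vector_tangent[OF c]
        smooth_field_near_coord_vector[OF c, of u]]
      by (intro has_derivative_mult_left) (simp add: coord_vector_christoffel[OF c] cA)
  qed
  have V': "((\<lambda>s. V s c) has_vector_derivative - ?\<Gamma> ?x' (V t c)) (at t within {a..b})"
    using V \<gamma>(3) c unfolding parallel_along_def by blast
  have "((\<lambda>s. B (chart_map c (\<gamma> s)) (V s c) 1) has_real_derivative
      B' (V t c) 1 ?x' + B (chart_map c (\<gamma> t)) (- ?\<Gamma> ?x' (V t c)) 1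
        + B (chart_map c (\<gamma> t)) (V t c) 0) (at t within {a..b})"
    by (rule bilinear_family_derivative[OF bil _ B' x' V' has_vector_derivative_const \<gamma>(3) d(1)])
      (use cA chart_open d(2) in auto)
  also have "B' (V t c) 1 ?x' + B (chart_map c (\<gamma> t)) (- ?\<Gamma> ?x' (V t c)) 1
        + B (chart_map c (\<gamma> t)) (V t c) 0 = 0"
    using bilinear_lneg[OF bil] bilinear_rzero[OF bil] cA by (simp add: B'_def)
  finally show ?thesis
  proof (rule has_field_derivative_transform_within[OF _ d(1) \<gamma>(3)])
    fix s assume s: "s \<in> {a..b}" "dist s t < d"
    have cs: "c \<in> charts_at A (\<gamma> s)" using d(2)[OF s] cA by (simp add: charts_at_def)
    have "V s \<in> tangent_space A (\<gamma> s)"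
      using V s(1) unfolding parallel_along_def by blast
    then show "B (chart_map c (\<gamma> s)) (V s c) 1 = \<theta> (\<gamma> s) (V s)"
      using d(2)[OF s] cA by (simp add: B_def coord_vector_of_coord[OF _ cs])
  qed
qed

lemma holonomy_tangent:
  "P \<in> holonomy_group A D p \<Longrightarrow> v \<in> tangent_space A p \<Longrightarrow> P v \<in> tangent_space A p"
  unfolding holonomy_group_def by auto

lemma holonomy_form:
  assumes "smooth_1form A \<theta>" "form_parallel A \<theta> D"
    and P: "P \<in> holonomy_group A D p" "v \<in> tangent_space A p"
  shows "\<theta> p (P v) = \<theta> p v"
proof -
  obtain \<gamma> N \<tau> V where \<gamma>: "\<gamma> 0 = p" "\<gamma> 1 = p" "\<tau> 0 = 0" "\<tau> N = 1"
      "\<And>i. i < N \<Longrightarrow> \<tau> i < \<tau> (Suc i) \<and> smooth_curve A \<gamma> (\<tau> i) (\<tau> (Suc i))"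
    and V: "V 0 = v" "V 1 = P v" "\<And>i. i < N \<Longrightarrow> parallel_along A D \<gamma> V (\<tau> i) (\<tau> (Suc i))"
    using P unfolding holonomy_group_def by blast
  have "\<theta> (\<gamma> (\<tau> N)) (V (\<tau> N)) = \<theta> (\<gamma> (\<tau> 0)) (V (\<tau> 0))"
    by (rule piecewise_constant[where h = "\<lambda>s. \<theta> (\<gamma> s) (V s)"]) (use \<gamma>(5) V(3) parallel_form_derivative_zero[OF assms(1,2)] in blast)+
  then show ?thesis by (simp add: \<gamma> V)
qed

lemma holonomy_bilinear:
  assumes "\<And>p u v w a b. u \<in> tangent_space A p \<Longrightarrow> v \<in> tangent_space A p \<Longrightarrow>
      w \<in> tangent_space A p \<Longrightarrow> \<beta> p (lincomb a u b v) w = a * \<beta> p u w + b * \<beta> p v w"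
    and "\<And>p u v w a b. u \<in> tangent_space A p \<Longrightarrow> v \<in> tangent_space A p \<Longrightarrow>
      w \<in> tangent_space A p \<Longrightarrow> \<beta> p w (lincomb a u b v) = a * \<beta> p w u + b * \<beta> p w v"
    and "\<And>U X Y. open U \<Longrightarrow> smooth_field_on A U X \<Longrightarrow> smooth_field_on A U Y \<Longrightarrow>
      smooth_fun_on A U (\<lambda>p. \<beta> p (X p) (Y p))"
    and "metric_parallel A \<beta> D"
    and P: "P \<in> holonomy_group A D p" "v \<in> tangent_space A p" "w \<in> tangent_space A p"
  shows "\<beta> p (P v) (P w) = \<beta> p v w"
proof -
  obtain \<gamma> N \<tau> where \<gamma>: "\<gamma> 0 = p" "\<gamma> 1 = p" "\<tau> 0 = 0" "\<tau> N = 1"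
      "\<And>i. i < N \<Longrightarrow> \<tau> i < \<tau> (Suc i) \<and> smooth_curve A \<gamma> (\<tau> i) (\<tau> (Suc i))"
    and *: "\<And>v. v \<in> tangent_space A p \<Longrightarrow> \<exists>V. V 0 = v \<and> V 1 = P v \<and>
          (\<forall>i<N. parallel_along A D \<gamma> V (\<tau> i) (\<tau> (Suc i)))"
    using P(1) unfolding holonomy_group_def by blast
  \<comment> \<open>The loop and its subdivision are fixed before the vector, so \<open>V\<close>
    and \<open>W\<close> are parallel along the same curve.\<close>
  obtain V where V: "V 0 = v" "V 1 = P v" "\<And>i. i < N \<Longrightarrow> parallel_along A D \<gamma> V (\<tau> i) (\<tau> (Suc i))"
    using *[OF P(2)] by blast
  obtain W where W: "W 0 = w" "W 1 = P w" "\<And>i. i < N \<Longrightarrow> parallel_along A D \<gamma> W (\<tau> i) (\<tau> (Suc i))"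
    using *[OF P(3)] by blast
  have "\<beta> (\<gamma> (\<tau> N)) (V (\<tau> N)) (W (\<tau> N)) = \<beta> (\<gamma> (\<tau> 0)) (V (\<tau> 0)) (W (\<tau> 0))"
    by (rule piecewise_constant[where h = "\<lambda>s. \<beta> (\<gamma> s) (V s) (W s)"])
      (use \<gamma>(5) V(3) W(3) parallel_bilinear_derivative_zero[OF assms(1-4)] in blast)+
  then show ?thesis by (simp add: \<gamma> V W)
qed

end

section \<open>A parallel one-form vanishes nowhere or everywhere\<close>

text \<open>A Gronwall estimate for the energy \<open>S\<close>, the sum of the squares of the
  \<open>f i\<close>. If \<open>K\<close> bounds the coefficients, then
  \<open>2 f_i M_ij f_j \<le> K (f_i^2 + f_j^2)\<close>; summing over both indices gives
  \<open>S' \<le> 2 K n S\<close> with \<open>n = card I\<close>. So \<open>S exp(- 2 K n t)\<close>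
  cannot increase from its initial value 0.\<close>

lemma linear_ode_zero:
  fixes f :: "'i \<Rightarrow> real \<Rightarrow> real"
  assumes "finite I" and cont: "\<And>i j. i \<in> I \<Longrightarrow> j \<in> I \<Longrightarrow> continuous_on {0..1} (M i j)"
    and f: "\<And>i t. i \<in> I \<Longrightarrow> t \<in> {0..1} \<Longrightarrow>
      (f i has_real_derivative (\<Sum>j\<in>I. M i j t * f j t)) (at t)"
    and f0: "\<And>i. i \<in> I \<Longrightarrow> f i 0 = 0" and i: "i \<in> I" and t: "t \<in> {0..1}"
  shows "f i t = 0"
proof -
  have "\<exists>k. \<forall>t\<in>{0..1}. \<bar>M i j t\<bar> \<le> k" if "i \<in> I" "j \<in> I" for i j
    using compact_imp_bounded[OF compact_continuous_image[OF cont[OF that] compact_Icc]]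
    by (auto simp: bounded_iff)
  then obtain k where k: "\<bar>M i j t\<bar> \<le> k i j" if "i \<in> I" "j \<in> I" "t \<in> {0..1}" for i j t
    by metis
  \<comment> \<open>The sum of all individual bounds is a common bound that also makes sense for an
    empty index set.\<close>
  define K where "K = (\<Sum>i\<in>I. \<Sum>j\<in>I. \<bar>k i j\<bar>)"
  have K: "\<bar>M i j t\<bar> \<le> K" if "i \<in> I" "j \<in> I" "t \<in> {0..1}" for i j t
  proof -
    have "\<bar>M i j t\<bar> \<le> \<bar>k i j\<bar>" using k[OF that] by linarith
    also have "\<dots> \<le> (\<Sum>j\<in>I. \<bar>k i j\<bar>)" using that assms(1) by (intro member_le_sum) auto
    also have "\<dots> \<le> K" unfolding K_def
      using that assms(1) by (intro member_le_sum[where f = "\<lambda>i. \<Sum>j\<in>I. \<bar>k i j\<bar>"] sum_nonneg) auto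
    finally show ?thesis .
  qed
  define n where "n = real (card I)"
  define S where "S t = (\<Sum>i\<in>I. (f i t)\<^sup>2)" for t
  define S' where "S' t = (\<Sum>i\<in>I. 2 * f i t * (\<Sum>j\<in>I. M i j t * f j t))" for t
  have S: "(S has_real_derivative S' t) (at t)" if "t \<in> {0..1}" for t
    unfolding S_def S'_def
    by (rule DERIV_sum) (auto intro!: derivative_eq_intros f that)
  have S'_le: "S' t \<le> 2 * K * n * S t" if t: "t \<in> {0..1}" for t
  proof -
    have "2 * f i t * (M i j t * f j t) \<le> K * ((f i t)\<^sup>2 + (f j t)\<^sup>2)" if "i \<in> I" "j \<in> I" for i j
    proof -
      have "2 * f i t * (M i j t * f j t) \<le> \<bar>M i j t\<bar> * (2 * \<bar>f i t\<bar> * \<bar>f j t\<bar>)"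
        using abs_ge_self[of "2 * f i t * (M i j t * f j t)"] by (simp add: abs_mult ac_simps)
      also have "\<dots> \<le> K * (2 * \<bar>f i t\<bar> * \<bar>f j t\<bar>)"
        by (intro mult_right_mono K that t) auto
      also have "2 * \<bar>f i t\<bar> * \<bar>f j t\<bar> \<le> (f i t)\<^sup>2 + (f j t)\<^sup>2"
        using sum_squares_bound[of "\<bar>f i t\<bar>" "\<bar>f j t\<bar>"] by simp
      finally show ?thesis using K[OF that t] by (simp add: mult_left_mono)
    qed
    then have "S' t \<le> (\<Sum>i\<in>I. \<Sum>j\<in>I. K * ((f i t)\<^sup>2 + (f j t)\<^sup>2))"
      unfolding S'_def sum_distrib_left by (intro sum_mono) auto
    also have "\<dots> = 2 * K * n * S t"
      by (simp add: S_def n_def sum.distrib distrib_left sum_distrib_left[symmetric] algebra_simps)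
    finally show ?thesis .
  qed
  have "S t * exp (- (2 * K * n) * t) \<le> S 0 * exp (- (2 * K * n) * 0)"
  proof (rule DERIV_nonpos_imp_nonincreasing[where f = "\<lambda>t. S t * exp (- (2 * K * n) * t)"])
    show "0 \<le> t" using t by simp
    fix s assume "0 \<le> s" "s \<le> t"
    then have s: "s \<in> {0..1}" using t by simp
    have "((\<lambda>t. S t * exp (- (2 * K * n) * t)) has_real_derivative
        (S' s - 2 * K * n * S s) * exp (- (2 * K * n) * s)) (at s)"
      by (auto intro!: derivative_eq_intros S s simp: algebra_simps)
    moreover have "(S' s - 2 * K * n * S s) * exp (- (2 * K * n) * s) \<le> 0"
      using S'_le[OF s] by (simp add: mult_le_0_iff)
    ultimately show "\<exists>y. ((\<lambda>t. S t * exp (- (2 * K * n) * t)) has_real_derivative y) (at s) \<and> y \<le> 0"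
      by blast
  qed
  also have "\<dots> = 0" by (simp add: S_def f0)
  finally have "S t \<le> 0" by (simp add: mult_le_0_iff)
  moreover have "(f i t)\<^sup>2 \<le> S t"
    unfolding S_def using i assms(1) by (intro member_le_sum) auto
  ultimately have "(f i t)\<^sup>2 \<le> 0" by linarith
  then show ?thesis by simp
qed

lemma (in smooth_manifold) open_chart_preimage:
  assumes "c \<in> A" "open W"
  shows "open (chart_dom c \<inter> chart_map c -` W)"
  using assms chart_open[OF assms(1)] chart_homeo[OF assms(1)]
  by (intro continuous_open_preimage) (auto simp: homeomorphism_def)

lemma (in smooth_manifold) open_1form_nonzero:
  assumes "smooth_1form A \<theta>"
  shows "open {p. \<exists>v\<in>tangent_space A p. \<theta> p v \<noteq> 0}"
proof (subst open_subopen, safe)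
  fix p v assume v: "v \<in> tangent_space A p" "\<theta> p v \<noteq> 0"
  obtain c where c: "c \<in> charts_at A p" using charts_at_nonempty by blast
  note cA = charts_atD[OF c]
  let ?f = "\<lambda>q. \<theta> q (coord_vector A c q (v c))"
  let ?S = "chart_map c ` chart_dom c"
  have "smooth_fun_on A (chart_dom c) ?f"
    using assms cA chart_open smooth_field_coord_vector[of c "v c"] unfolding smooth_1form_def
    by blast
  then have "continuous_on ?S (?f \<circ> chart_inv c)"
    using cA unfolding smooth_fun_on_def by (intro smooth_on_continuous) auto
  then have "open (?S \<inter> (?f \<circ> chart_inv c) -` (- {0}))"
    using chart_open cA by (intro continuous_open_preimage) auto
  then have o: "open (chart_dom c \<inter> chart_map c -` (?S \<inter> (?f \<circ> chart_inv c) -` (- {0})))"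
    using open_chart_preimage cA by blast
  show "\<exists>T. open T \<and> p \<in> T \<and> T \<subseteq> {p. \<exists>v\<in>tangent_space A p. \<theta> p v \<noteq> 0}"
  proof (intro exI conjI subsetI)
    show "p \<in> chart_dom c \<inter> chart_map c -` (?S \<inter> (?f \<circ> chart_inv c) -` (- {0}))"
      using cA v by (simp add: coord_vector_of_coord[OF v(1) c])
    fix q assume q: "q \<in> chart_dom c \<inter> chart_map c -` (?S \<inter> (?f \<circ> chart_inv c) -` (- {0}))"
    then have "chart_inv c (chart_map c q) = q" using cA by simp
    with q have "c \<in> charts_at A q" "?f q \<noteq> 0" using cA by (simp_all add: charts_at_def)
    then show "q \<in> {p. \<exists>v\<in>tangent_space A p. \<theta> p v \<noteq> 0}"
      using coord_vector_tangent by blast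
  qed (rule o)
qed

section \<open>The zero set of a parallel one-form\<close>

context linear_connection
begin

lemma christoffel_continuous:
  assumes "c \<in> A"
  shows "continuous_on (chart_map c ` chart_dom c) (\<lambda>x. christoffel A D c (chart_inv c x) u w)"
proof -
  have "smooth_field_on A (chart_dom c)
      (\<lambda>p. D p (coord_vector A c p u) (\<lambda>q. coord_vector A c q w))"
    using assms chart_open by (intro connection_smooth smooth_field_coord_vector) auto
  then have "smooth_on (chart_map c ` (chart_dom c \<inter> chart_dom c))
      (\<lambda>x. christoffel A D c (chart_inv c x) u w)"
    using assms unfolding smooth_field_on_def christoffel_def by blast
  then show ?thesis by (auto dest: smooth_on_continuous)
qed

text \<open>A point \<open>q\<close> in a chart ball around a zero \<open>p\<close> is joined to
  \<open>p\<close> by the straight segment \<open>y\<close>. Along it the components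
  \<open>f\<close> of \<theta> in the coordinate frame solve a linear system whose matrix
  \<open>M\<close> consists of Christoffel coefficients. They vanish at time 0, hence at time
  1.\<close>

lemma open_1form_zero:
  assumes \<theta>: "smooth_1form A \<theta>" and parallel: "form_parallel A \<theta> D"
  shows "open {p. \<forall>v\<in>tangent_space A p. \<theta> p v = 0}"
proof (subst open_subopen, safe)
  fix p assume zero: "\<forall>v\<in>tangent_space A p. \<theta> p v = 0"
  obtain c where c: "c \<in> charts_at A p" using charts_at_nonempty by blast
  note cA = charts_atD[OF c]
  let ?S = "chart_map c ` chart_dom c" and ?x = "chart_map c p"
  have "open ?S" "?x \<in> ?S" using cA chart_open by auto
  then obtain r where r: "r > 0" "ball ?x r \<subseteq> ?S" using open_contains_ball by metis
  have vanish: "\<theta> q v = 0" if q: "q \<in> chart_dom c" "chart_map c q \<in> ball ?x r"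
    and v: "v \<in> tangent_space A q" for q v
  proof -
    define h where "h = chart_map c q - ?x"
    define y where "y t = ?x + t *\<^sub>R h" for t :: real
    have yS: "y t \<in> ?S" if "t \<in> {0..1}" for t
    proof -
      have "norm (t *\<^sub>R h) \<le> norm h" using that by (simp add: mult_left_le_one_le)
      also have "\<dots> < r" using q(2) by (simp add: h_def dist_norm norm_minus_commute)
      finally show ?thesis using r(2) by (auto simp: y_def dist_norm)
    qed
    have cy: "c \<in> charts_at A (chart_inv c (y t))" "chart_map c (chart_inv c (y t)) = y t"
      if "t \<in> {0..1}" for t
      using yS[OF that] cA by (auto simp: charts_at_def)
    define f where "f i t = \<theta> (chart_inv c (y t)) (coord_vector A c (chart_inv c (y t)) i)" for i t
    define M where "M i j t = inner (christoffel A D c (chart_inv c (y t)) h i) j" for i j t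
    have f': "(f i has_real_derivative (\<Sum>j\<in>Basis. M i j t * f j t)) (at t)"
      if t: "t \<in> {0..1}" for i t
    proof -
      let ?q = "chart_inv c (y t)"
      have "smooth_fun_on A (chart_dom c) (\<lambda>q. \<theta> q (coord_vector A c q i))"
        using \<theta> cA chart_open smooth_field_coord_vector[of c i] unfolding smooth_1form_def by blast
      from smooth_fun_chart_derivative[OF cy(1)[OF t] this]
      have F: "((\<lambda>z. \<theta> (chart_inv c z) (coord_vector A c (chart_inv c z) i)) has_derivative
          (\<lambda>h. \<theta> ?q (coord_vector A c ?q (christoffel A D c ?q h i)))) (at (y t))"
        using form_parallelD[OF parallel coord_vector_tangent[OF cy(1)[OF t]]
          smooth_field_near_coord_vector[OF cy(1)[OF t], of i]]
        by (simp add: coord_vector_christoffel[OF cy(1)[OF t]] cy(2)[OF t])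
      have "(y has_vector_derivative h) (at t)"
        unfolding y_def by (auto intro!: derivative_eq_intros)
      from vector_derivative_diff_chain_within[OF this has_derivative_at_withinI[OF F]]
      have "(f i has_real_derivative \<theta> ?q (coord_vector A c ?q (christoffel A D c ?q h i))) (at t)"
        unfolding has_real_derivative_iff_has_vector_derivative f_def comp_def .
      moreover have "\<theta> ?q (coord_vector A c ?q w) = (\<Sum>j\<in>Basis. inner w j * f j t)" for w
      proof -
        note lin = linear_1form_chart[OF \<theta> cy(1)[OF t]]
        have "\<theta> ?q (coord_vector A c ?q (\<Sum>j\<in>Basis. inner w j *\<^sub>R j)) = (\<Sum>j\<in>Basis. inner w j * f j t)"
          unfolding f_def by (subst linear_sum[OF lin]) (simp add: linear_scale[OF lin])
        then show ?thesis by (simp only: euclidean_representation)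
      qed
      ultimately show ?thesis by (simp only: M_def)
    qed
    have f1: "f i 1 = 0" if "i \<in> Basis" for i
    proof (rule linear_ode_zero[of Basis M f, OF finite_Basis _ _ _ that])
      show "f i 0 = 0" for i
        using zero cA coord_vector_tangent[OF c] by (simp add: f_def y_def)
      show "continuous_on {0..1} (M i j)" for i j
        unfolding M_def
      proof (intro continuous_intros)
        have "continuous_on {0..1} y" unfolding y_def by (intro continuous_intros)
        from continuous_on_compose2[OF christoffel_continuous this]
        show "continuous_on {0..1} (\<lambda>t. christoffel A D c (chart_inv c (y t)) h i)"
          using cA yS by blast
      qed
    qed (use f' that in auto)
    have y1: "chart_inv c (y 1) = q" using cA q by (simp add: y_def h_def)
    have cq: "c \<in> charts_at A q" using cA q by (simp add: charts_at_def)
    note lin = linear_1form_chart[OF \<theta> cq]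
    have "\<theta> q (coord_vector A c q (\<Sum>j\<in>Basis. inner (v c) j *\<^sub>R j)) = 0"
      by (subst linear_sum[OF lin]) (use f1 in \<open>simp add: linear_scale[OF lin] f_def y1\<close>)
    then show ?thesis by (simp only: euclidean_representation coord_vector_of_coord[OF v cq])
  qed
  show "\<exists>T. open T \<and> p \<in> T \<and> T \<subseteq> {p. \<forall>v\<in>tangent_space A p. \<theta> p v = 0}"
    using open_chart_preimage[of c "ball ?x r"] cA r(1) vanish
    by (intro exI[of _ "chart_dom c \<inter> chart_map c -` ball ?x r"]) auto
qed

lemma parallel_1form_nonzero:
  assumes "smooth_1form A \<theta>" "form_parallel A \<theta> D" "connected (UNIV :: 'm set)"
    and "\<exists>p. \<exists>v\<in>tangent_space A p. \<theta> p v \<noteq> 0"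
  shows "\<exists>v\<in>tangent_space A p. \<theta> p v \<noteq> 0"
proof -
  let ?Z = "{p. \<exists>v\<in>tangent_space A p. \<theta> p v \<noteq> 0}"
  have "- ?Z = {p. \<forall>v\<in>tangent_space A p. \<theta> p v = 0}" by auto
  then have "closed ?Z" using open_1form_zero[OF assms(1,2)] by (simp add: closed_def)
  moreover have "T = {} \<or> T = UNIV" if "open T" "closed T" for T :: "'m set"
    using assms(3) that by (simp add: connected_clopen)
  ultimately have "?Z = {} \<or> ?Z = UNIV" using open_1form_nonzero[OF assms(1)] by blast
  then show ?thesis using assms(4) by blast
qed

end

section \<open>Unitary frames\<close>

text \<open>The model of one tangent space on \<open>'e\<close>: \<open>G\<close> is the metric and
  \<open>K\<close> the complex structure, read in a chart.\<close>

locale hermitian_space =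
  fixes G :: "'e::euclidean_space \<Rightarrow> 'e \<Rightarrow> real" and K :: "'e \<Rightarrow> 'e"
  assumes G_bilinear: "bilinear G" and G_sym: "G x y = G y x" and G_pos: "x \<noteq> 0 \<Longrightarrow> G x x > 0"
    and K_square: "K (K x) = - x" and K_isometry: "G (K x) (K y) = G x y"
begin

lemmas G_simps = bilinear_ladd[OF G_bilinear] bilinear_radd[OF G_bilinear]
  bilinear_lmul[OF G_bilinear] bilinear_rmul[OF G_bilinear] bilinear_lneg[OF G_bilinear]
  bilinear_rneg[OF G_bilinear] bilinear_lzero[OF G_bilinear] bilinear_rzero[OF G_bilinear]
  bilinear_lsub[OF G_bilinear] bilinear_rsub[OF G_bilinear]

lemma G_linear: "linear (\<lambda>x. G x y)" "linear (G x)"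
  using G_bilinear by (auto simp: bilinear_def)

lemma G_eq_0: "G x x = 0 \<Longrightarrow> x = 0"
  using G_pos[of x] by force

lemma K_left: "G (K x) y = - G x (K y)"
  using K_isometry[of "K x" y] by (simp add: K_square G_simps)

lemma K_self: "G x (K x) = 0" "G (K x) x = 0"
  using K_left[of x x] G_sym[of x "K x"] by auto

lemma orthogonal_family_card:
  assumes "finite I" and nz: "\<And>i. i \<in> I \<Longrightarrow> f i \<noteq> 0"
    and orth: "\<And>i j. i \<in> I \<Longrightarrow> j \<in> I \<Longrightarrow> i \<noteq> j \<Longrightarrow> G (f i) (f j) = 0"
  shows "card I \<le> DIM('e)"
proof -
  have inj: "inj_on f I"
    using nz orth G_eq_0 by (metis inj_onI)
  have "independent (f ` I)"
  proof (rule real_vector.independent_if_scalars_zero)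
    fix a x assume 0: "(\<Sum>x\<in>f ` I. a x *\<^sub>R x) = 0" and "x \<in> f ` I"
    then obtain i where i: "i \<in> I" "x = f i" by blast
    have "0 = G (\<Sum>j\<in>I. a (f j) *\<^sub>R f j) (f i)"
      using 0 by (simp add: sum.reindex[OF inj] G_simps)
    also have "\<dots> = (\<Sum>j\<in>I. a (f j) * G (f j) (f i))"
      by (subst linear_sum[OF G_linear(1)]) (simp add: G_simps)
    also have "\<dots> = (\<Sum>j\<in>I. if j = i then a (f i) * G (f i) (f i) else 0)"
      by (intro sum.cong) (auto simp: orth i)
    also have "\<dots> = a (f i) * G (f i) (f i)" using assms(1) i by simp
    finally show "a x = 0" using G_eq_0[of "f i"] nz i by auto
  qed (use assms(1) in simp)
  then show ?thesis using independent_bound card_image[OF inj] by metis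
qed

definition frame :: "nat \<Rightarrow> (nat \<Rightarrow> 'e) \<Rightarrow> bool" where
  "frame k e \<longleftrightarrow>
    (\<forall>i<k. \<forall>j<k. G (e i) (e j) = (if i = j then 1 else 0) \<and> G (K (e i)) (e j) = 0)"

lemma common_orthogonal:
  assumes "finite U" "card U < DIM('e)"
  obtains x where "x \<noteq> 0" "\<And>u. u \<in> U \<Longrightarrow> G u x = 0"
proof -
  \<comment> \<open>Representing each functional \<open>G u\<close> by the Euclidean inner product
    turns \<open>G\<close>-orthogonality into ordinary orthogonality, for which the dimension count
    is available.\<close>
  have "\<exists>a. \<forall>x. G u x = inner a x" for u
    by (rule bilinear_riesz)
      (auto simp: bilinear_def G_linear intro!: linearI simp: inner_add_left inner_add_right)
  then obtain a where a: "\<And>u x. G u x = inner (a u) x" by metis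
  have "dim (a ` U) \<le> card U"
    using dim_le_card'[of "a ` U"] card_image_le[OF assms(1), of a] assms(1) by simp
  then obtain x where x: "x \<noteq> 0" "\<And>y. y \<in> span (a ` U) \<Longrightarrow> inner x y = 0"
    using orthogonal_to_subspace_exists[of "a ` U"] assms(2)
    by (auto simp: real_inner_class.orthogonal_def)
  show thesis
  proof (rule that[OF x(1)])
    fix u assume "u \<in> U"
    then have "inner x (a u) = 0" by (intro x(2) span_base) simp
    then show "G u x = 0" by (simp add: a inner_commute)
  qed
qed

lemma frame_extend:
  assumes e: "frame k e" and k: "2 * k < DIM('e)"
  obtains x where "frame (Suc k) (e(k := x))"
proof -
  \<comment> \<open>The new vector must be orthogonal to each \<open>K (e i)\<close> as well; by
    \<open>K_left\<close> this makes \<open>K x\<close> orthogonal to \<open>e i\<close>. These are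
    at most \<open>2 * k\<close> conditions, fewer than the dimension.\<close>
  let ?U = "e ` {..<k} \<union> (\<lambda>i. K (e i)) ` {..<k}"
  have "card ?U \<le> card (e ` {..<k}) + card ((\<lambda>i. K (e i)) ` {..<k})" by (rule card_Un_le)
  also have "\<dots> \<le> k + k"
    using card_image_le[of "{..<k}" e] card_image_le[of "{..<k}" "\<lambda>i. K (e i)"] by simp
  finally obtain y where y: "y \<noteq> 0" "\<And>u. u \<in> ?U \<Longrightarrow> G u y = 0"
    using common_orthogonal[of ?U] k by auto
  define x where "x = (1 / sqrt (G y y)) *\<^sub>R y"
  have "G x x = 1" using G_pos[OF y(1)] by (simp add: x_def G_simps)
  moreover have x: "G (e i) x = 0" "G (K (e i)) x = 0" if "i < k" for i
    using y(2)[of "e i"] y(2)[of "K (e i)"] that by (simp_all add: x_def G_simps)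
  moreover have "G x (e i) = 0" "G (K x) (e i) = 0" if "i < k" for i
    using x[OF that] G_sym[of x] K_left[of x "e i"] by simp_all
  ultimately have "frame (Suc k) (e(k := x))"
    using e by (auto simp: frame_def less_Suc_eq K_self)
  then show thesis by (rule that)
qed

lemma frame_exists:
  assumes "1 \<le> k" "2 * k \<le> DIM('e)" "G b b = 1"
  shows "\<exists>e. frame k e \<and> e 0 = b"
  using assms(1,2)
proof (induction k rule: dec_induct)
  case base
  show ?case by (rule exI[of _ "\<lambda>_. b"]) (simp add: frame_def assms(3) K_self)
next
  case (step k)
  then obtain e where "frame k e" "e 0 = b" by auto
  moreover obtain x where "frame (Suc k) (e(k := x))"
    using frame_extend[OF \<open>frame k e\<close>] step.prems by auto
  moreover have "(e(k := x)) 0 = e 0" using step.hyps by simp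
  ultimately show ?case by metis
qed

lemma frame_expand:
  assumes e: "frame n e" and n: "DIM('e) = 2 * n"
  shows "v = (\<Sum>i<n. G v (e i) *\<^sub>R e i + G v (K (e i)) *\<^sub>R K (e i))"
proof (rule ccontr)
  let ?s = "\<Sum>i<n. G v (e i) *\<^sub>R e i + G v (K (e i)) *\<^sub>R K (e i)"
  assume "v \<noteq> ?s"
  define w where "w = v - ?s"
  have orth: "G (e i) (e j) = (if i = j then 1 else 0)" "G (K (e i)) (e j) = 0"
    "G (e i) (K (e j)) = 0" "G (K (e i)) (K (e j)) = (if i = j then 1 else 0)"
    if "i < n" "j < n" for i j
    using e that G_sym[of "e i" "K (e j)"] by (auto simp: frame_def K_isometry)
  have w: "G w (e j) = 0" "G w (K (e j)) = 0" if "j < n" for j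
  proof -
    have "G ?s (e j) = (\<Sum>i<n. if i = j then G v (e j) else 0)"
      unfolding linear_sum[OF G_linear(1)]
      by (intro sum.cong) (auto simp: G_simps orth that)
    then show "G w (e j) = 0" using that by (simp add: w_def G_simps)
    have "G ?s (K (e j)) = (\<Sum>i<n. if i = j then G v (K (e j)) else 0)"
      unfolding linear_sum[OF G_linear(1)]
      by (intro sum.cong) (auto simp: G_simps orth that)
    then show "G w (K (e j)) = 0" using that by (simp add: w_def G_simps)
  qed
  \<comment> \<open>A non-zero remainder \<open>w\<close> would yield \<open>2 * n + 1\<close>
    mutually orthogonal non-zero vectors: \<open>None\<close> indexes \<open>w\<close>,
    \<open>Some (i, True)\<close> indexes \<open>e i\<close> and \<open>Some (i, False)\<close>
    indexes \<open>K (e i)\<close>. Their distinctness is left to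
    \<open>orthogonal_family_card\<close>.\<close>
  define f where "f = (\<lambda>x. case x of None \<Rightarrow> w | Some (i, s) \<Rightarrow> if s then e i else K (e i))"
  let ?I = "insert None (Some ` ({..<n} \<times> (UNIV :: bool set)))"
  have "card ?I \<le> DIM('e)"
  proof (rule orthogonal_family_card)
    fix x assume "x \<in> ?I"
    then show "f x \<noteq> 0"
      using \<open>v \<noteq> ?s\<close> orth(1,4) by (auto simp: f_def w_def G_simps) (metis G_simps(7) zero_neq_one)+
  next
    fix x y assume "x \<in> ?I" "y \<in> ?I" "x \<noteq> y"
    then show "G (f x) (f y) = 0"
      using w G_sym[of _ w] orth by (auto simp: f_def split: if_splits)
  qed simp
  moreover have "card ?I = Suc (2 * n)" by (simp add: card_image card_insert_if)
  ultimately show False using n by simp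
qed

text \<open>Conjugate linear in the second argument.\<close>

definition H :: "'e \<Rightarrow> 'e \<Rightarrow> complex" where
  "H v w = Complex (G v w) (G v (K w))"

definition comb :: "nat \<Rightarrow> (nat \<Rightarrow> 'e) \<Rightarrow> complex Matrix.vec \<Rightarrow> 'e" where
  "comb n e z = (\<Sum>i<n. Re (vec_index z i) *\<^sub>R e i + Im (vec_index z i) *\<^sub>R K (e i))"

lemma H_add_left: "H (u + v) w = H u w + H v w"
  by (simp add: H_def G_simps complex_eq_iff)

lemma H_sum_left: "H (\<Sum>i\<in>I. f i) w = (\<Sum>i\<in>I. H (f i) w)"
  by (induction I rule: infinite_finite_induct)
    (simp_all add: H_add_left, simp_all add: H_def G_simps complex_eq_iff)

lemma H_scale_left: "H (a *\<^sub>R v + b *\<^sub>R K v) w = Complex a b * H v w"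
  by (simp add: H_def G_simps complex_eq_iff K_isometry K_left K_square)

lemma H_frame: "frame n e \<Longrightarrow> i < n \<Longrightarrow> j < n \<Longrightarrow> H (e i) (e j) = (if i = j then 1 else 0)"
  using G_sym[of "e i" "K (e j)"] by (auto simp: frame_def H_def complex_eq_iff)

lemma H_comb: "H (comb n e z) w = (\<Sum>i<n. vec_index z i * H (e i) w)"
  by (simp add: comb_def H_sum_left H_scale_left)

lemma comb_H:
  assumes "frame n e" "DIM('e) = 2 * n"
  shows "comb n e (Matrix.vec n (\<lambda>i. H v (e i))) = v"
  using frame_expand[OF assms, of v] by (simp add: comb_def H_def)

lemma H_eqI:
  assumes "frame n e" "DIM('e) = 2 * n" "\<And>i. i < n \<Longrightarrow> H v (e i) = H w (e i)"
  shows "v = w"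
proof -
  have "Matrix.vec n (\<lambda>i. H v (e i)) = Matrix.vec n (\<lambda>i. H w (e i))"
    using assms(3) by (intro eq_vecI) auto
  then show ?thesis using comb_H[OF assms(1,2)] by metis
qed

lemma H_commute: "H w v = cnj (H v w)"
  using K_left[of v w] G_sym[of w "K v"] G_sym[of w v] by (simp add: H_def complex_eq_iff)

lemma H_parseval:
  assumes "frame n e" "DIM('e) = 2 * n"
  shows "H v w = (\<Sum>i<n. H v (e i) * cnj (H w (e i)))"
proof -
  have "H v w = H (comb n e (Matrix.vec n (\<lambda>i. H v (e i)))) w"
    by (simp add: comb_H[OF assms])
  also have "\<dots> = (\<Sum>i<n. H v (e i) * H (e i) w)" by (simp add: H_comb)
  finally show ?thesis by (simp add: H_commute[of _ w])
qed

end

section \<open>Isometries of a Hermitian space and their matrices\<close>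

locale hermitian_isometry = hermitian_space +
  fixes P :: "'a \<Rightarrow> 'a"
  assumes P_G: "G (P x) (P y) = G x y" and P_K: "G (K (P x)) (P y) = G (K x) y"
begin

lemma P_H: "H (P x) (P y) = H x y"
  using P_G[of x y] P_K[of x y] by (simp add: H_def K_left)

text \<open>Linearity need not be assumed: the squared length of the defect expands to \<open>0\<close>.\<close>

lemma P_linear: "P (a *\<^sub>R x + b *\<^sub>R y) = a *\<^sub>R P x + b *\<^sub>R P y"
proof -
  let ?d = "P (a *\<^sub>R x + b *\<^sub>R y) - (a *\<^sub>R P x + b *\<^sub>R P y)"
  have "G ?d ?d = 0"
    by (simp add: G_simps P_G algebra_simps)
  then show ?thesis using G_eq_0[of ?d] by simp
qed

text \<open>Another defect of squared length 0: \<open>P_K\<close> for \<open>x\<close> and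
  \<open>K x\<close> evaluates the mixed term to \<open>G x x\<close>, so the expansion reads
  \<open>G x x - 2 * G x x + G x x\<close>.\<close>

lemma P_commute: "P (K x) = K (P x)"
proof -
  let ?d = "P (K x) - K (P x)"
  have "G (P (K x)) (K (P x)) = G x x"
    using P_K[of x "K x"] by (simp add: G_sym K_isometry)
  then have "G ?d ?d = 0"
    using G_sym[of "K (P x)" "P (K x)"] by (simp add: G_simps P_G K_isometry)
  then show ?thesis using G_eq_0[of ?d] by simp
qed

lemma P_0: "P 0 = 0"
  using P_linear[of 0 _ 0] by simp

lemma P_comb: "P (comb n e z) = comb n (\<lambda>i. P (e i)) z"
proof -
  have "P (\<Sum>i\<in>I. f i) = (\<Sum>i\<in>I. P (f i))" for f :: "nat \<Rightarrow> 'a" and I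
    using P_linear[of 1 _ 1] P_0 by (induction I rule: infinite_finite_induct) simp_all
  then show ?thesis by (simp add: comb_def P_linear P_commute)
qed

text \<open>The matrix has entries \<open>H (P (e j)) (e i)\<close>. Its first column is a unit
  vector because \<open>P\<close> fixes \<open>e 0\<close>, and its first row because then
  \<open>H (P (e j)) (e 0) = H (P (e j)) (P (e 0)) = H (e j) (e 0)\<close>. The remaining block is
  \<open>C\<close>.\<close>

lemma matrix_in_unitary_subgroup:
  assumes e: "frame n e" and n: "DIM('a) = 2 * n" "0 < n" and P0: "P (e 0) = e 0"
  shows "\<exists>B\<in>unitary_subgroup n. \<forall>z\<in>carrier_vec n. P (comb n e z) = comb n e (B *\<^sub>v z)"
proof -
  let ?h = "\<lambda>i j. H (P (e j)) (e i)"
  define C where "C = Matrix.mat (n - 1) (n - 1) (\<lambda>(i,j). ?h (Suc i) (Suc j))"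
  define B where "B = four_block_mat (1\<^sub>m 1) (0\<^sub>m 1 (n - 1)) (0\<^sub>m (n - 1) 1) C"
  have row0: "?h 0 j = (if j = 0 then 1 else 0)" if "j < n" for j
    using P_H[of "e j" "e 0"] H_frame[OF e that, of 0] n(2) by (auto simp: P0)
  have col0: "?h i 0 = (if i = 0 then 1 else 0)" if "i < n" for i
    using H_frame[OF e _ that, of 0] n(2) by (auto simp: P0)
  have C: "C \<in> carrier_mat (n - 1) (n - 1)" by (simp add: C_def)
  have B: "B = Matrix.mat n n (\<lambda>(i,j). ?h i j)"
    using n(2) row0 col0 by (intro eq_matI) (auto simp: B_def C_def)
  have adj: "mat_adjoint C \<in> carrier_mat (n - 1) (n - 1)"
    "\<And>i j. i < n - 1 \<Longrightarrow> j < n - 1 \<Longrightarrow> mat_adjoint C $$ (i, j) = cnj (C $$ (j, i))"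
    by (auto simp: mat_adjoint_def C_def mat_of_rows_def)
  have "mat_adjoint C * C = 1\<^sub>m (n - 1)"
  proof (rule eq_matI)
    fix i j assume "i < dim_row (1\<^sub>m (n - 1) :: complex mat)" "j < dim_col (1\<^sub>m (n - 1) :: complex mat)"
    then have ij: "i < n - 1" "j < n - 1" by auto
    have "(mat_adjoint C * C) $$ (i, j) = (\<Sum>k<n - 1. cnj (?h (Suc k) (Suc i)) * ?h (Suc k) (Suc j))"
      using ij adj C by (auto simp: scalar_prod_def C_def lessThan_atLeast0 intro!: sum.cong)
    \<comment> \<open>The term of index 0 may be added, since \<open>row0\<close> makes its factor
      in column \<open>Suc i\<close> vanish; the result is a full Parseval sum.\<close>
    also have "\<dots> = (\<Sum>k<n. ?h k (Suc j) * cnj (?h k (Suc i)))"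
      using n(2) row0[of "Suc i"] ij by (cases n) (simp_all add: sum.lessThan_Suc_shift mult.commute del: sum.lessThan_Suc)
    also have "\<dots> = H (P (e (Suc j))) (P (e (Suc i)))"
      by (rule H_parseval[OF e n(1), symmetric])
    also have "\<dots> = 1\<^sub>m (n - 1) $$ (i, j)"
      using ij by (auto simp: P_H H_frame[OF e])
    finally show "(mat_adjoint C * C) $$ (i, j) = 1\<^sub>m (n - 1) $$ (i, j)" .
  qed (use adj C in auto)
  then have "C \<in> unitary_group (n - 1)"
    using mat_mult_left_right_inverse[OF adj(1) C] C by (simp add: unitary_group_def)
  then have "B \<in> unitary_subgroup n" unfolding unitary_subgroup_def B_def by (rule imageI)
  moreover have "P (comb n e z) = comb n e (B *\<^sub>v z)" if z: "z \<in> carrier_vec n" for z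
  proof (rule H_eqI[OF e n(1)])
    fix i assume i: "i < n"
    have "H (comb n e (B *\<^sub>v z)) (e i) = vec_index (B *\<^sub>v z) i"
      using i by (simp add: H_comb H_frame[OF e] if_distrib[of "\<lambda>x. _ * x"] cong: if_cong)
    also have "\<dots> = (\<Sum>j<n. ?h i j * vec_index z j)"
      using i z by (auto simp: B scalar_prod_def lessThan_atLeast0)
    finally show "H (P (comb n e z)) (e i) = H (comb n e (B *\<^sub>v z)) (e i)"
      by (simp add: P_comb H_comb mult.commute)
  qed
  ultimately show ?thesis by blast
qed

end

section \<open>Holonomy of the Bismut connection\<close>

context hermitian_manifold
begin

lemma coord_vector_J:
  assumes "c \<in> charts_at A p"
  shows "coord_vector A c p (J p (coord_vector A c p x) c) = J p (coord_vector A c p x)"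
  by (intro coord_vector_of_coord J_tangent coord_vector_tangent assms)

lemma hermitian_space_chart:
  assumes c: "c \<in> charts_at A p"
  shows "hermitian_space (\<lambda>x y. g p (coord_vector A c p x) (coord_vector A c p y))
    (\<lambda>x. J p (coord_vector A c p x) c)"
proof
  note t = coord_vector_tangent[OF c]
  show "bilinear (\<lambda>x y. g p (coord_vector A c p x) (coord_vector A c p y))"
    by (rule bilinear_metric[OF c])
  show "g p (coord_vector A c p x) (coord_vector A c p y)
    = g p (coord_vector A c p y) (coord_vector A c p x)" for x y
    by (intro metric_sym t)
  show "x \<noteq> 0 \<Longrightarrow> g p (coord_vector A c p x) (coord_vector A c p x) > 0" for x
    by (rule metric_chart_pos[OF c])
  show "J p (coord_vector A c p (J p (coord_vector A c p x) c)) c = - x" for x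
    by (simp add: coord_vector_J[OF c] J_square[OF t] coord_vector_self[OF c])
  show "g p (coord_vector A c p (J p (coord_vector A c p x) c))
      (coord_vector A c p (J p (coord_vector A c p y) c))
    = g p (coord_vector A c p x) (coord_vector A c p y)" for x y
    by (simp only: coord_vector_J[OF c] hermitian[OF t t])
qed

lemma complex_comb_chart:
  assumes c: "c \<in> charts_at A p"
  shows "complex_comb J p n (\<lambda>i. coord_vector A c p (e i)) z
    = coord_vector A c p (\<Sum>i<n. Re (vec_index z i) *\<^sub>R e i
        + Im (vec_index z i) *\<^sub>R J p (coord_vector A c p (e i)) c)"
proof
  fix c'
  have coord: "coord_vector A c p (a *\<^sub>R x + b *\<^sub>R y) c'
      = a *\<^sub>R coord_vector A c p x c' + b *\<^sub>R coord_vector A c p y c'" for a b x y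
    using lincomb_coord_vector[OF c, of a x b y] by (simp add: lincomb_def fun_eq_iff)
  have lin: "linear (\<lambda>x. coord_vector A c p x c')"
    by (rule linearI) (use coord[of 1 _ 1] coord[of _ _ 0] in simp_all)
  show "complex_comb J p n (\<lambda>i. coord_vector A c p (e i)) z c'
    = coord_vector A c p (\<Sum>i<n. Re (vec_index z i) *\<^sub>R e i
        + Im (vec_index z i) *\<^sub>R J p (coord_vector A c p (e i)) c) c'"
    unfolding complex_comb_def linear_sum[OF lin] by (simp add: coord coord_vector_J[OF c])
qed

lemma holonomy_metric:
  assumes "bismut_connection A J g D" "P \<in> holonomy_group A D p"
    "v \<in> tangent_space A p" "w \<in> tangent_space A p"
  shows "g p (P v) (P w) = g p v w"
proof -
  interpret D: linear_connection A D
    using assms(1) by (simp add: bismut_connection_def)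
  show ?thesis
    by (rule D.holonomy_bilinear[OF _ _ _ _ assms(2-4)])
      (use assms(1) in \<open>auto simp: metric_linear metric_linear_right bismut_connection_def
        intro: metric_smooth\<close>)
qed

lemma holonomy_fundamental_form:
  assumes "bismut_connection A J g D" "P \<in> holonomy_group A D p"
    "v \<in> tangent_space A p" "w \<in> tangent_space A p"
  shows "g p (J p (P v)) (P w) = g p (J p v) w"
proof -
  interpret D: linear_connection A D
    using assms(1) by (simp add: bismut_connection_def)
  have D: "metric_parallel A g D" "endo_parallel A J D"
    using assms(1) by (simp_all add: bismut_connection_def)
  show ?thesis
  proof (rule D.holonomy_bilinear[OF _ _ _ _ assms(2-4), where \<beta> = "\<lambda>p u v. g p (J p u) v"])
    show "smooth_fun_on A U (\<lambda>p. g p (J p (X p)) (Y p))"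
      if "open U" "smooth_field_on A U X" "smooth_field_on A U Y" for U X Y
      by (intro metric_smooth[OF that(1)] J_smooth that)
    \<comment> \<open>For \<omega> in place of the metric, parallelism follows from that of
      \<open>g\<close> and of \<open>J\<close>.\<close>
    show "metric_parallel A (\<lambda>p u. g p (J p u)) D"
      unfolding metric_parallel_def
      using metric_parallelD[OF D(1) _ J_near] endo_parallelD[OF D(2)] by auto
  qed (auto simp: J_linear J_tangent metric_linear metric_linear_right)
qed

end

theorem corollary3p8:
  fixes A :: "('m::{second_countable_topology, t2_space}, 'e::euclidean_space) chart set"
    and J :: "'m \<Rightarrow> ('m, 'e) tangent \<Rightarrow> ('m, 'e) tangent"
    and g :: "'m \<Rightarrow> ('m, 'e) tangent \<Rightarrow> ('m, 'e) tangent \<Rightarrow> real"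
    and \<theta> :: "'m \<Rightarrow> ('m, 'e) tangent \<Rightarrow> real"
    and D :: "('m, 'e) connection"
    and n :: nat
  assumes "vaisman_manifold A J g \<theta>"
    and "connected (UNIV :: 'm set)"
    and "DIM('e) = 2 * n" and "2 * n \<ge> 4"
    and "\<exists>p. \<exists>v\<in>tangent_space A p. \<theta> p v \<noteq> 0"
    and "bismut_connection A J g D"
  shows "\<forall>p. \<exists>e. unitary_basis A J g n p e \<and>
           holonomy_contained A J D n p e (unitary_subgroup n)"
proof
  fix p
  interpret vaisman_manifold A J g \<theta> by fact
  interpret D: linear_connection A D
    using assms(6) by (simp add: bismut_connection_def)
  note parallel = lee_form_bismut_parallel[OF assms(6)]
  obtain c where c: "c \<in> charts_at A p" using charts_at_nonempty by blast
  note t = coord_vector_tangent[OF c]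
  let ?c = "coord_vector A c p"
  let ?G = "\<lambda>x y. g p (?c x) (?c y)" and ?K = "\<lambda>x. J p (?c x) c"
  interpret h: hermitian_space ?G ?K by (rule hermitian_space_chart[OF c])
  obtain b where b: "b \<in> tangent_space A p" "\<And>v. v \<in> tangent_space A p \<Longrightarrow> \<theta> p v = g p b v"
    using metric_riesz[OF lee_form] by blast
  have cb: "?c (b c) = b" by (rule coord_vector_of_coord[OF b(1) c])
  have \<theta>: "\<theta> p (?c x) = ?G (b c) x" for x by (simp add: b(2) t cb)
  obtain v where "v \<in> tangent_space A p" "\<theta> p v \<noteq> 0"
    using D.parallel_1form_nonzero[OF lee_form parallel assms(2,5)] by blast
  then have "?G (b c) (v c) \<noteq> 0" using \<theta>[of "v c"] by (simp add: coord_vector_of_coord[OF _ c])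
  then have "b c \<noteq> 0" using h.G_simps(7) by metis
  then have pos: "?G (b c) (b c) > 0" by (rule h.G_pos)
  \<comment> \<open>The normalised dual of \<theta> is to be the first basis vector, which spans the
    complex line on which the subgroup acts by the entry 1.\<close>
  define u where "u = (1 / sqrt (?G (b c) (b c))) *\<^sub>R b c"
  have "?G u u = 1" using pos by (simp add: u_def h.G_simps)
  then obtain e where e: "h.frame n e" "e 0 = u"
    using h.frame_exists[of n u] assms(3,4) by auto
  have "unitary_basis A J g n p (\<lambda>i. ?c (e i))"
    using e(1) by (simp add: unitary_basis_def h.frame_def t coord_vector_J[OF c])
  moreover have "holonomy_contained A J D n p (\<lambda>i. ?c (e i)) (unitary_subgroup n)"
    unfolding holonomy_contained_def
  proof
    fix P assume P: "P \<in> holonomy_group A D p"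
    define P' where "P' x = P (?c x) c" for x
    have cP': "?c (P' x) = P (?c x)" for x
      unfolding P'_def by (intro coord_vector_of_coord D.holonomy_tangent[OF P] t c)
    interpret P: hermitian_isometry ?G ?K P'
      by standard (unfold coord_vector_J[OF c],
          simp_all only: cP' holonomy_metric[OF assms(6) P t t]
            holonomy_fundamental_form[OF assms(6) P t t])
    have "?G (b c) (P' x) = ?G (b c) x" for x
      using D.holonomy_form[OF lee_form parallel P t] \<theta>[of x] \<theta>[of "P' x"] by (simp only: cP')
    then have u: "?G u (P' x) = ?G u x" for x by (simp add: u_def h.G_simps)
    \<comment> \<open>Invariance of \<theta> controls only the component of \<open>P' u\<close>
      along \<open>u\<close>. As \<open>P' u\<close> also has the length of \<open>u\<close>, the
      expansion is \<open>G u u - 2 * G u u + G u u\<close>, which forces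
      \<open>P' u = u\<close>.\<close>
    have "?G (P' u - u) (P' u - u) = 0"
      using u[of u] P.P_G[of u u] h.G_sym[of u "P' u"] by (simp add: h.G_simps)
    then have "P' (e 0) = e 0" using h.G_eq_0[of "P' u - u"] e(2) by simp
    then obtain B where B: "B \<in> unitary_subgroup n"
        "\<And>z. z \<in> carrier_vec n \<Longrightarrow> P' (h.comb n e z) = h.comb n e (B *\<^sub>v z)"
      using P.matrix_in_unitary_subgroup[OF e(1) assms(3)] assms(4) by auto
    have comb: "complex_comb J p n (\<lambda>i. ?c (e i)) z = ?c (h.comb n e z)" for z
      by (simp add: complex_comb_chart[OF c] h.comb_def)
    show "\<exists>B\<in>unitary_subgroup n. \<forall>z\<in>carrier_vec n. P (complex_comb J p n (\<lambda>i. ?c (e i)) z)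
        = complex_comb J p n (\<lambda>i. ?c (e i)) (B *\<^sub>v z)"
      by (intro bexI[OF _ B(1)] ballI) (simp only: comb cP'[symmetric] B(2))
  qed
  ultimately show "\<exists>e. unitary_basis A J g n p e \<and>
           holonomy_contained A J D n p e (unitary_subgroup n)"
    by (intro exI conjI)
qed

end
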